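(* Let $A$ be a separable $C^*$-algebra, $n\ge1$, and $J$ a fixed real skew-symmetric $n\times n$ matrix. Let $a\in CB^\infty(\mathbb{R}^{2n},A)$ and let $T=a(x,D)$ be the corresponding pseudodifferential operator on $E$. If $T$ commutes with all the operators $G(x+JD)=R_G$, $G\in S^A(\mathbb{R}^n)$, then there exists $F\in CB^\infty(\mathbb{R}^n,A)$ such that $T=F(x-JD)=L_F$, the pseudodifferential operator with symbol $(x,\xi)\mapsto F(x-J\xi)$.
   Context: $A$ is a separable $C^*$-algebra. $S^A(\mathbb{R}^n)$ is the space of Schwartz functions $\mathbb{R}^n\to A$, with $A$-valued inner product $\langle f,g\rangle=\int f(x)^*g(x)\,dx$ and norm $\|f\|_2=\|\langle f,f\rangle\|_A^{1/2}$. $E$ is its completion, a (right) Hilbert $A$-module. $CB^\infty(\mathbb{R}^m,A)$ is the set of $C^\infty$ functions $\mathbb{R}^m\to A$ bounded together with all their derivatives. For $a\in CB^\infty(\mathbb{R}^{2n},A)$, $a(x,D)$ is the operator given on $\varphi\in S^A(\mathbb{R}^n)$ by $$a(x,D)\varphi(x)=(2\pi)^{-n}\int\!\!\int e^{i(x-y)\cdot\xi}a(x,\xi)\varphi(y)\,dy\,d\xi=(2\pi)^{-n/2}\int e^{ix\cdot\xi}a(x,\xi)\hat\varphi(\xi)\,d\xi,$$ with $\hat\varphi(\xi)=(2\pi)^{-n/2}\int e^{-i\xi\cdot y}\varphi(y)\,dy$; it extends to a bounded adjointable operator on $E$. Rieffel's deformed product (oscillatory integral): $F\times_JG(x)=(2\pi)^{-n}\int\!\int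 e^{iu\cdot v}F(x+Ju)G(x+v)\,du\,dv$. For $F\in CB^\infty(\mathbb{R}^n,A)$, $L_F\varphi=F\times_J\varphi$ ($\varphi\in S^A(\mathbb{R}^n)$), which is the pseudodifferential operator with symbol $F(x-J\xi)$, denoted $F(x-JD)$. For $G\in S^A(\mathbb{R}^n)$, the operator $G(x+JD)$ is the one obtained from the right regular representation of the deformed product: $R_Gf=f\times_JG$ for $f\in S^A(\mathbb{R}^n)$, extended by continuity to a bounded operator on $E$. *)

theory Defs
  imports "HOL-Analysis.Analysis"
begin

section \<open>C*-algebras\<close>

class scaleC = scaleR +
  fixes scaleC :: "complex \<Rightarrow> 'a \<Rightarrow> 'a"  (infixr "*\<^sub>C" 75)

class complex_banach = scaleC + banach +
  assumes scaleC_add_right: "c *\<^sub>C (x + y) = c *\<^sub>C x + c *\<^sub>C y"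
    and scaleC_add_left: "(c + d) *\<^sub>C x = c *\<^sub>C x + d *\<^sub>C x"
    and scaleC_scaleC: "c *\<^sub>C d *\<^sub>C x = (c * d) *\<^sub>C x"
    and scaleR_scaleC: "r *\<^sub>R x = complex_of_real r *\<^sub>C x"
    and norm_scaleC: "norm (c *\<^sub>C x) = cmod c * norm x"

text \<open>No unit is required.\<close>

class cstar_algebra = complex_banach + real_normed_algebra +
  fixes star :: "'a \<Rightarrow> 'a"
  assumes mult_scaleC_left: "(c *\<^sub>C x) * y = c *\<^sub>C (x * y)"
    and mult_scaleC_right: "x * (c *\<^sub>C y) = c *\<^sub>C (x * y)"
    and star_add: "star (x + y) = star x + star y"
    and star_scaleC: "star (c *\<^sub>C x) = cnj c *\<^sub>C star x"
    and star_mult: "star (x * y) = star y * star x"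
    and star_star: "star (star x) = x"
    and cstar_identity: "norm (star x * x) = (norm x)\<^sup>2"

class separable_cstar_algebra = cstar_algebra +
  assumes separable: "\<exists>D. countable D \<and> (\<forall>x. \<forall>e>0. \<exists>d\<in>D. dist d x < e)"

text \<open>The Bochner integral of the library is only available for second countable value spaces.\<close>

instance separable_cstar_algebra \<subseteq> second_countable_topology
proof
  obtain D :: "'a set" where D: "countable D" "\<And>x e. e > 0 \<Longrightarrow> \<exists>d\<in>D. dist d x < e"
    using separable by blast
  define B where "B = (\<lambda>(d, k). ball d (inverse (real (Suc k)))) ` (D \<times> (UNIV :: nat set))"
  have "countable B"
    using D(1) by (simp add: B_def)
  moreover have "topological_basis B"
  proof (rule topological_basisI)
    fix S assume "S \<in> B" then show "open S" by (auto simp: B_def)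
  next
    fix S :: "'a set" and x assume "open S" "x \<in> S"
    then obtain e where e: "e > 0" "ball x e \<subseteq> S" by (meson openE)
    obtain k where k: "inverse (real (Suc k)) < e / 2"
      using e(1) reals_Archimedean by (metis half_gt_zero)
    obtain d where d: "d \<in> D" "dist d x < inverse (real (Suc k))"
      using D(2)[of "inverse (real (Suc k))" x] by auto
    have "ball d (inverse (real (Suc k))) \<subseteq> ball x e"
    proof
      fix y assume "y \<in> ball d (inverse (real (Suc k)))"
      then have "dist x y < e"
        using d(2) k dist_triangle[of x y d] by (simp add: dist_commute)
      then show "y \<in> ball x e" by simp
    qed
    then show "\<exists>B'\<in>B. x \<in> B' \<and> B' \<subseteq> S"
      using d e(2) unfolding B_def
      by (intro bexI[of _ "ball d (inverse (real (Suc k)))"]) auto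
  qed
  ultimately show "\<exists>B::'a set set. countable B \<and> open = generate_topology B"
    using topological_basis_imp_subbasis by blast
qed

section \<open>Smooth functions\<close>

text \<open>\<open>iter_partial [v\<^sub>1, \<dots>, v\<^sub>k] f\<close> is the iterated directional derivative along
  \<open>v\<^sub>k\<close>, \dots, \<open>v\<^sub>1\<close> (in this order of application).\<close>

fun iter_partial ::
  "'b::euclidean_space list \<Rightarrow> ('b \<Rightarrow> 'a::real_normed_vector) \<Rightarrow> 'b \<Rightarrow> 'a" where
  "iter_partial [] f = f"
| "iter_partial (v # vs) f = (\<lambda>x. frechet_derivative (iter_partial vs f) (at x) v)"

definition smooth :: "('b::euclidean_space \<Rightarrow> 'a::real_normed_vector) \<Rightarrow> bool" where
  "smooth f \<longleftrightarrow> (\<forall>vs\<in>lists Basis. iter_partial vs f differentiable_on UNIV)"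

definition CB_inf :: "('b::euclidean_space \<Rightarrow> 'a::real_normed_vector) set" where
  "CB_inf = {f. smooth f \<and> (\<forall>vs\<in>lists Basis. bounded (range (iter_partial vs f)))}"

definition schwartz :: "('b::euclidean_space \<Rightarrow> 'a::real_normed_vector) set" where
  "schwartz = {f. smooth f \<and>
     (\<forall>vs\<in>lists Basis. \<forall>k. bounded (range (\<lambda>x. norm x ^ k *\<^sub>R iter_partial vs f x)))}"

section \<open>The Hilbert module completing the Schwartz space\<close>

definition schwartz_inner ::
  "(real^'n \<Rightarrow> 'a) \<Rightarrow> (real^'n \<Rightarrow> 'a) \<Rightarrow> 'a::separable_cstar_algebra" where
  "schwartz_inner f g = (LINT x|lborel. star (f x) * g x)"

text \<open>Positivity of \<open>\<langle>x, x\<rangle>\<close> is expressed by its being of the form \<open>b\<^sup>* b\<close>.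
  Completeness of the module is that of the Banach space carrying it.\<close>

locale hilbert_module =
  fixes ip :: "'e::complex_banach \<Rightarrow> 'e \<Rightarrow> 'a::cstar_algebra"
    and act :: "'e \<Rightarrow> 'a \<Rightarrow> 'e"
  assumes act_add_left: "act (x + y) a = act x a + act y a"
    and act_add_right: "act x (a + b) = act x a + act x b"
    and act_mult: "act x (a * b) = act (act x a) b"
    and act_scaleC_left: "act (c *\<^sub>C x) a = c *\<^sub>C act x a"
    and act_scaleC_right: "act x (c *\<^sub>C a) = c *\<^sub>C act x a"
    and ip_add_right: "ip x (y + z) = ip x y + ip x z"
    and ip_scaleC_right: "ip x (c *\<^sub>C y) = c *\<^sub>C ip x y"
    and ip_act_right: "ip x (act y a) = ip x y * a"
    and ip_star: "star (ip x y) = ip y x"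
    and ip_positive: "\<exists>b. ip x x = star b * b"
    and norm_ip: "norm x = sqrt (norm (ip x x))"

text \<open>The completion is characterised up to unique isomorphism: a Hilbert module together with
  an inner product preserving module map \<open>\<iota>\<close> from the Schwartz space onto a dense subspace.
  The values of \<open>\<iota>\<close> outside \<^const>\<open>schwartz\<close> are irrelevant.\<close>

locale schwartz_completion = hilbert_module ip act
  for ip :: "'e::complex_banach \<Rightarrow> 'e \<Rightarrow> 'a::separable_cstar_algebra"
    and act :: "'e \<Rightarrow> 'a \<Rightarrow> 'e" +
  fixes \<iota> :: "(real^'n \<Rightarrow> 'a) \<Rightarrow> 'e"
  assumes emb_add: "\<lbrakk>f \<in> schwartz; g \<in> schwartz\<rbrakk> \<Longrightarrow> \<iota> (\<lambda>x. f x + g x) = \<iota> f + \<iota> g"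
    and emb_scaleC: "f \<in> schwartz \<Longrightarrow> \<iota> (\<lambda>x. c *\<^sub>C f x) = c *\<^sub>C \<iota> f"
    and emb_act: "f \<in> schwartz \<Longrightarrow> \<iota> (\<lambda>x. f x * a) = act (\<iota> f) a"
    and emb_ip: "\<lbrakk>f \<in> schwartz; g \<in> schwartz\<rbrakk> \<Longrightarrow> ip (\<iota> f) (\<iota> g) = schwartz_inner f g"
    and emb_dense: "closure (\<iota> ` schwartz) = UNIV"

text \<open>\<open>T\<close> is the (unique) bounded extension to the completion of the operator \<open>P\<close> on the
  Schwartz space.\<close>

definition extends_to ::
  "((real^'n \<Rightarrow> 'a::real_normed_vector) \<Rightarrow> 'e::real_normed_vector) \<Rightarrow>
   ((real^'n \<Rightarrow> 'a) \<Rightarrow> (real^'n \<Rightarrow> 'a)) \<Rightarrow> ('e \<Rightarrow> 'e) \<Rightarrow> bool" where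
  "extends_to \<iota> P T \<longleftrightarrow>
     bounded_linear T \<and> (\<forall>\<phi>\<in>schwartz. P \<phi> \<in> schwartz \<and> T (\<iota> \<phi>) = \<iota> (P \<phi>))"

section \<open>Pseudodifferential operators\<close>

definition fourier :: "(real^'n \<Rightarrow> 'a) \<Rightarrow> real^'n \<Rightarrow> 'a::separable_cstar_algebra" where
  "fourier \<phi> \<xi> = (2 * pi) powr (- real CARD('n) / 2) *\<^sub>R
     (LINT y|lborel. cis (- (\<xi> \<bullet> y)) *\<^sub>C \<phi> y)"

definition pseudo_diff ::
  "((real^'n) \<times> (real^'n) \<Rightarrow> 'a) \<Rightarrow> (real^'n \<Rightarrow> 'a) \<Rightarrow> real^'n \<Rightarrow> 'a::separable_cstar_algebra" where
  "pseudo_diff a \<phi> x = (2 * pi) powr (- real CARD('n) / 2) *\<^sub>R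
     (LINT \<xi>|lborel. cis (x \<bullet> \<xi>) *\<^sub>C (a (x, \<xi>) * fourier \<phi> \<xi>))"

section \<open>Rieffel's deformed product\<close>

text \<open>Oscillatory integrals, regularised by an arbitrary Schwartz cut-off \<open>\<psi>\<close>
  with \<open>\<psi>(0) = 1\<close>; the limit must exist and be the same for all cut-offs.\<close>

definition has_osc_integral ::
  "('b::euclidean_space \<Rightarrow> 'a::separable_cstar_algebra) \<Rightarrow> 'a \<Rightarrow> bool" where
  "has_osc_integral h l \<longleftrightarrow>
     (\<forall>\<psi>::'b \<Rightarrow> complex. \<psi> \<in> schwartz \<longrightarrow> \<psi> 0 = 1 \<longrightarrow>
        ((\<lambda>\<epsilon>. LINT z|lborel. \<psi> (\<epsilon> *\<^sub>R z) *\<^sub>C h z) \<longlongrightarrow> l) (at_right 0))"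

definition osc_integral ::
  "('b::euclidean_space \<Rightarrow> 'a) \<Rightarrow> 'a::separable_cstar_algebra" where
  "osc_integral h = (THE l. has_osc_integral h l)"

definition deformed_product ::
  "real^'n^'n \<Rightarrow> (real^'n \<Rightarrow> 'a) \<Rightarrow> (real^'n \<Rightarrow> 'a) \<Rightarrow> real^'n \<Rightarrow> 'a::separable_cstar_algebra"
  where
  "deformed_product J F G x = (2 * pi) powr (- real CARD('n)) *\<^sub>R
     osc_integral (\<lambda>(u, v). cis (u \<bullet> v) *\<^sub>C (F (x + J *v u) * G (x + v)))"

definition left_mult ::
  "real^'n^'n \<Rightarrow> (real^'n \<Rightarrow> 'a) \<Rightarrow> (real^'n \<Rightarrow> 'a) \<Rightarrow> real^'n \<Rightarrow> 'a::separable_cstar_algebra"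
  where "left_mult J F \<phi> = deformed_product J F \<phi>"

definition right_mult ::
  "real^'n^'n \<Rightarrow> (real^'n \<Rightarrow> 'a) \<Rightarrow> (real^'n \<Rightarrow> 'a) \<Rightarrow> real^'n \<Rightarrow> 'a::separable_cstar_algebra"
  where "right_mult J G f = deformed_product J f G"

end

(* The symbol must be invariant under (x, \<xi>) \<mapsto> (x + Jp, \<xi> + p), so that F = a(-, 0) works.
   R_G is the superposition, with weight the Fourier transform of G, of the Weyl translations
   f(x) \<mapsto> exp(i x.p) f(x - Jp). Take f(x) = exp(-s^2 |x|^2 / 2) d and G(x) = exp(i q.x) exp(-s^2 |x|^2 / 2) b
   with d, b in A. Then a(x,D) R_G f and R_G a(x,D) f at x are both double integrals over (p, \<xi>)
   with the same Gaussian weight, which concentrates at (q, 0) as s tends to 0; the integrands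
   carry a(x, p + \<xi>) d b and a(x - Jp, \<xi>) d b. Hence a(x, q) d b = a(x - Jq, 0) d b, and d, b are
   arbitrary, which makes up for the missing unit. Gaussians also show that \<iota> is injective, which
   turns commutation on E into pointwise commutation on Schwartz functions. *)

theory Submission
  imports Defs "HOL-Probability.Probability"
begin

section \<open>Complex scalars\<close>

text \<open>The obstacle is that \<open>deformed_product\<close> is a limit of regularised
  integrals, required to exist and to agree for all Schwartz cut-offs. If the left factor is bounded
  and continuous and the right factor \<phi> is Schwartz, the v-integral becomes in the limit a
  Fourier integral of \<phi> at -u, so all rests on a decay in u that is uniform in the
  regularisation parameter; integration by parts provides it. The product is then the operator with
  symbol F(x - J\<xi>) applied to \<phi>. This identity serves in two ways: with a Schwartz function
  as left factor it gives the integral formula for R_G, and with F = a(-, 0) it recognises the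
  operator with the invariant symbol as L_F. Both composites carry the same nonzero constant, and
  for each s their difference is a Gaussian average of one bounded continuous function that does not
  depend on s. Vanishing of these averages for all s > 0 forces that function to vanish at the
  centre.\<close>

lemma bounded_bilinear_scaleC:
  "bounded_bilinear ((*\<^sub>C) :: complex \<Rightarrow> 'a::complex_banach \<Rightarrow> 'a)"
proof
  show "(r *\<^sub>R z) *\<^sub>C x = r *\<^sub>R z *\<^sub>C x" for r and z and x :: 'a
    by (simp add: scaleR_scaleC[of r] scaleC_scaleC scaleR_conv_of_real)
  show "z *\<^sub>C (r *\<^sub>R x) = r *\<^sub>R z *\<^sub>C x" for r and z and x :: 'a
    by (simp add: scaleR_scaleC[of r] scaleC_scaleC mult.commute)
  show "\<exists>K. \<forall>z x. norm (z *\<^sub>C (x :: 'a)) \<le> norm z * norm x * K"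
    by (intro exI[of _ 1]) (simp add: norm_scaleC)
qed (auto simp: scaleC_add_left scaleC_add_right)

interpretation scaleC: bounded_bilinear "(*\<^sub>C) :: complex \<Rightarrow> 'a::complex_banach \<Rightarrow> 'a"
  by (rule bounded_bilinear_scaleC)

lemma scaleC_one: "1 *\<^sub>C x = (x :: 'a::complex_banach)"
  using scaleR_scaleC[of 1 x] by simp

lemma scaleR_scaleC_left: "(r *\<^sub>R z) *\<^sub>C x = r *\<^sub>R z *\<^sub>C (x :: 'a::complex_banach)"
  by (rule scaleC.scaleR_left)

lemma scaleC_scaleR_right: "z *\<^sub>C (r *\<^sub>R x) = r *\<^sub>R z *\<^sub>C (x :: 'a::complex_banach)"
  by (rule scaleC.scaleR_right)

lemma continuous_on_scaleC [continuous_intros]: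
  fixes g :: "_ \<Rightarrow> 'a::complex_banach"
  shows "continuous_on S f \<Longrightarrow> continuous_on S g \<Longrightarrow> continuous_on S (\<lambda>x. f x *\<^sub>C g x)"
  by (rule scaleC.continuous_on)

lemma star_zero: "star (0 :: 'a::cstar_algebra) = 0"
  using star_scaleC[of 0 "0 :: 'a"] by (simp add: scaleC.zero_left)

text \<open>Testing against \<open>b = star x\<close> gives \<open>x * star x = 0\<close>, and the
  C*-identity applied to \<open>star x\<close> forces \<open>star x = 0\<close>.\<close>

lemma left_annihilator_zero:
  fixes x :: "'a::cstar_algebra"
  assumes "\<And>b. x * b = 0"
  shows "x = 0"
proof -
  have "norm (star x) ^ 2 = 0"
    using assms[of "star x"] cstar_identity[of "star x"] by (simp add: star_star)
  then show ?thesis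
    using star_star[of x] star_zero by (metis norm_eq_zero zero_eq_power2)
qed

lemma right_annihilator_zero:
  fixes x :: "'a::cstar_algebra"
  assumes "\<And>b. star b * x = 0"
  shows "x = 0"
  using assms[of x] cstar_identity[of x] by simp

section \<open>Schwartz functions\<close>

lemma iter_partial_append: "iter_partial (vs @ ws) f = iter_partial vs (iter_partial ws f)"
  by (induction vs) auto

text \<open>All iterated partial derivatives of a member stay in \<open>S\<close>, so decay has to
  be checked only for the members themselves. This replaces closed formulas for higher derivatives
  by a choice of \<open>S\<close>.\<close>

lemma schwartz_coinduct:
  assumes "f \<in> S"
    and diff: "\<And>f x. f \<in> S \<Longrightarrow> f differentiable (at x)"
    and decay: "\<And>f k. f \<in> S \<Longrightarrow> bounded (range (\<lambda>x. norm x ^ k *\<^sub>R f x))"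
    and step: "\<And>f b. f \<in> S \<Longrightarrow> b \<in> Basis \<Longrightarrow> (\<lambda>x. frechet_derivative f (at x) b) \<in> S"
  shows "f \<in> schwartz"
proof -
  have "iter_partial vs f \<in> S" if "vs \<in> lists Basis" for vs
    using that by induction (auto intro: assms)
  then show ?thesis
    using diff decay unfolding schwartz_def smooth_def
    by (auto simp: differentiable_on_def intro: differentiable_at_withinI)
qed

lemma schwartz_partial:
  assumes "f \<in> schwartz" "b \<in> Basis"
  shows "(\<lambda>x. frechet_derivative f (at x) b) \<in> schwartz"
proof -
  have eq: "iter_partial vs (\<lambda>x. frechet_derivative f (at x) b) = iter_partial (vs @ [b]) f" for vs
    by (simp add: iter_partial_append)
  have "vs @ [b] \<in> lists Basis" if "vs \<in> lists Basis" for vs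
    using that assms(2) by auto
  with assms(1) show ?thesis
    unfolding schwartz_def smooth_def by (auto simp: eq)
qed

lemma schwartz_differentiable: "f \<in> schwartz \<Longrightarrow> f differentiable (at x)"
  unfolding schwartz_def smooth_def differentiable_on_def
  by (metis (no_types, lifting) UNIV_I iter_partial.simps(1) lists.Nil mem_Collect_eq)

lemma schwartz_has_derivative:
  "f \<in> schwartz \<Longrightarrow> (f has_derivative frechet_derivative f (at x)) (at x)"
  using schwartz_differentiable frechet_derivative_works by blast

lemma schwartz_continuous: "f \<in> schwartz \<Longrightarrow> continuous_on S f"
  by (meson continuous_at_imp_continuous_on differentiable_imp_continuous_within
      schwartz_differentiable)

text \<open>Combines the seminorms of order 0 and 2k. The weight 1 + |x|^2 never vanishes, so the
  bound is usable near the origin as well, and with k equal to the dimension it is an integrable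
  majorant.\<close>

lemma schwartz_decay:
  assumes "f \<in> schwartz"
  obtains C where "\<And>x. norm (f x) \<le> C / (1 + (norm x)\<^sup>2) ^ k"
proof -
  have bd: "\<exists>B. \<forall>x. norm x ^ j * norm (f x) \<le> B" for j
  proof -
    have "bounded (range (\<lambda>x. norm x ^ j *\<^sub>R iter_partial [] f x))"
      using assms unfolding schwartz_def by blast
    then show ?thesis
      by (auto simp: bounded_iff)
  qed
  obtain B0 where B0: "\<And>x. norm (f x) \<le> B0"
    using bd[of 0] by auto
  obtain Bk where Bk: "\<And>x. norm x ^ (2 * k) * norm (f x) \<le> Bk"
    using bd[of "2 * k"] by auto
  have "norm (f x) \<le> (2 ^ k * (B0 + Bk)) / (1 + (norm x)\<^sup>2) ^ k" for x
  proof -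
    have "(1 + (norm x)\<^sup>2) ^ k \<le> (2 * max 1 ((norm x)\<^sup>2)) ^ k"
      by (intro power_mono) auto
    also have "\<dots> \<le> 2 ^ k * (1 + norm x ^ (2 * k))"
      by (auto simp: max_def power_mult_distrib power_mult)
    finally have "(1 + (norm x)\<^sup>2) ^ k * norm (f x) \<le> 2 ^ k * (1 + norm x ^ (2 * k)) * norm (f x)"
      by (rule mult_right_mono) simp
    also have "\<dots> = 2 ^ k * (norm (f x) + norm x ^ (2 * k) * norm (f x))"
      by (simp add: algebra_simps)
    also have "\<dots> \<le> 2 ^ k * (B0 + Bk)"
      using B0[of x] Bk[of x] by (intro mult_left_mono) auto
    finally show ?thesis
      by (simp add: pos_le_divide_eq add_pos_nonneg mult.commute)
  qed
  then show ?thesis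
    using that by blast
qed

lemma schwartz_bounded:
  assumes "f \<in> schwartz"
  obtains C where "C \<ge> 0" "\<And>x. norm (f x) \<le> C"
proof -
  obtain C where C: "\<And>x. norm (f x) \<le> C / (1 + (norm x)\<^sup>2) ^ 0"
    using schwartz_decay[OF assms] by blast
  have "C \<ge> 0"
    using order_trans[OF norm_ge_zero C] by simp
  with C show ?thesis
    using that by simp
qed

section \<open>Integration over Euclidean space\<close>

lemma integral_lborel_affine:
  fixes f :: "'b::euclidean_space \<Rightarrow> 'a::{banach, second_countable_topology}"
  assumes c: "c \<noteq> 0" and [measurable]: "f \<in> borel_measurable borel"
  shows "(LINT x|lborel. f x) = \<bar>c\<bar> ^ DIM('b) *\<^sub>R (LINT x|lborel. f (t + c *\<^sub>R x))"
  by (subst lborel_affine[OF c, of t]) (simp add: integral_density integral_distr)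

lemma integrable_lborel_affine:
  fixes f :: "'b::euclidean_space \<Rightarrow> 'a::{banach, second_countable_topology}"
  assumes c: "c \<noteq> 0" and f: "integrable lborel f"
  shows "integrable lborel (\<lambda>x. f (t + c *\<^sub>R x))"
proof -
  have [measurable]: "f \<in> borel_measurable borel"
    using f by simp
  have "integrable (density (distr lborel borel (\<lambda>x. t + c *\<^sub>R x)) (\<lambda>_. ennreal (\<bar>c\<bar>^DIM('b)))) f"
    using f by (subst (asm) lborel_affine[OF c, of t]) (simp add: ennreal_power)
  then have "integrable lborel (\<lambda>x. \<bar>c\<bar> ^ DIM('b) *\<^sub>R f (t + c *\<^sub>R x))"
    by (simp add: integrable_density integrable_distr_eq)
  from integrable_scaleR_right[OF this, of "inverse (\<bar>c\<bar> ^ DIM('b))"] c show ?thesis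
    by simp
qed

lemma integral_lborel_translate:
  fixes f :: "'b::euclidean_space \<Rightarrow> 'a::{banach, second_countable_topology}"
  assumes "f \<in> borel_measurable borel"
  shows "(LINT x|lborel. f (t + x)) = (LINT x|lborel. f x)"
  using integral_lborel_affine[OF _ assms, of 1 t] by simp

lemma integral_lborel_reflect:
  fixes f :: "'b::euclidean_space \<Rightarrow> 'a::{banach, second_countable_topology}"
  assumes "f \<in> borel_measurable borel"
  shows "(LINT x|lborel. f (- x)) = (LINT x|lborel. f x)"
  using integral_lborel_affine[OF _ assms, of "-1" 0] by simp

text \<open>Lebesgue measure is the image of a product of one-dimensional Lebesgue measures under
  recombining coordinates. The intended integrands are \<open>decay_weight\<close> and Gaussians
  with a character, both of which factor over the coordinates.\<close>

lemma lborel_Basis_prod: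
  fixes f :: "'b::euclidean_space \<Rightarrow> real \<Rightarrow> 'c::{real_normed_field, banach, second_countable_topology}"
  assumes f: "\<And>b. b \<in> Basis \<Longrightarrow> integrable lborel (f b)"
  shows integrable_lborel_Basis_prod: "integrable lborel (\<lambda>x. \<Prod>b\<in>Basis. f b (x \<bullet> b))"
    and integral_lborel_Basis_prod:
      "(LINT x|lborel. (\<Prod>b\<in>Basis. f b (x \<bullet> b))) = (\<Prod>b\<in>Basis. (LINT t|lborel. f b t))"
proof -
  interpret product_sigma_finite "\<lambda>_::'b. lborel :: real measure"
    by standard
  have [measurable]: "f b \<in> borel_measurable borel" if "b \<in> Basis" for b
    using f[OF that] by simp
  have m: "(\<lambda>x::'b. \<Prod>b\<in>Basis. f b (x \<bullet> b)) \<in> borel_measurable borel"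
    by measurable
  have m': "(\<lambda>f. \<Sum>b\<in>Basis. f b *\<^sub>R b :: 'b) \<in> (\<Pi>\<^sub>M b\<in>(Basis :: 'b set). (lborel :: real measure)) \<rightarrow>\<^sub>M borel"
    by measurable
  have eq: "(\<Prod>b\<in>Basis. f b ((\<Sum>c\<in>Basis. g c *\<^sub>R c) \<bullet> b)) = (\<Prod>b\<in>Basis. f b (g b))" for g
    by (intro prod.cong refl) (simp add: inner_sum_left inner_Basis if_distrib sum.delta cong: if_cong)
  show "integrable lborel (\<lambda>x. \<Prod>b\<in>Basis. f b (x \<bullet> b))"
    by (subst lborel_eq, subst integrable_distr_eq[OF m' m], subst eq)
      (intro product_integrable_prod f finite_Basis)
  show "(LINT x|lborel. (\<Prod>b\<in>Basis. f b (x \<bullet> b))) = (\<Prod>b\<in>Basis. (LINT t|lborel. f b t))"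
    by (subst lborel_eq, subst integral_distr[OF m' m], subst eq)
      (intro product_integral_prod f finite_Basis)
qed

section \<open>Integrable majorants\<close>

text \<open>A product rather than a radial weight: this is the shape that two integrations by parts
  per coordinate produce, and its integrability reduces to that of 1 / (1 + t^2) on the
  line.\<close>

definition decay_weight :: "'b::euclidean_space \<Rightarrow> real" where
  "decay_weight x = (\<Prod>b\<in>Basis. inverse (1 + (x \<bullet> b)\<^sup>2))"

lemma integrable_decay_weight: "integrable lborel (decay_weight :: 'b::euclidean_space \<Rightarrow> real)"
proof -
  have "integrable lborel (\<lambda>x::real. inverse (1 + x\<^sup>2))"
    using integrable_inverse_1_plus_square by (simp add: set_integrable_def)
  then show ?thesis
    unfolding decay_weight_def by (rule integrable_lborel_Basis_prod)
qed

lemma decay_weight_pos: "decay_weight x > 0"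
  unfolding decay_weight_def by (intro prod_pos) (auto simp: add_pos_nonneg)

text \<open>The factor 1 + |x|^2 dominates each coordinate factor 1 + (x . b)^2; matching them one
  by one is why the exponent is the dimension.\<close>

lemma inverse_power_le_decay_weight:
  fixes x :: "'b::euclidean_space"
  shows "1 / (1 + (norm x)\<^sup>2) ^ DIM('b) \<le> decay_weight x"
proof -
  have "1 / (1 + (norm x)\<^sup>2) ^ DIM('b) = (\<Prod>b\<in>(Basis :: 'b set). inverse (1 + (norm x)\<^sup>2))"
    by (simp add: power_inverse field_simps)
  also have "\<dots> \<le> decay_weight x"
    unfolding decay_weight_def
  proof (intro prod_mono conjI)
    fix b :: 'b assume b: "b \<in> Basis"
    have "(x \<bullet> b)\<^sup>2 \<le> (norm x)\<^sup>2"
      using Basis_le_norm[OF b, of x] by (metis abs_ge_zero power2_abs power_mono)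
    then show "inverse (1 + (norm x)\<^sup>2) \<le> inverse (1 + (x \<bullet> b)\<^sup>2)"
      by (intro le_imp_inverse_le) (auto simp: add_pos_nonneg)
  qed auto
  finally show ?thesis .
qed

lemma integrable_inverse_power:
  "integrable lborel (\<lambda>x::'b::euclidean_space. C / (1 + (norm x)\<^sup>2) ^ DIM('b))"
proof -
  have "integrable lborel (\<lambda>x::'b. 1 / (1 + (norm x)\<^sup>2) ^ DIM('b))"
    by (rule Bochner_Integration.integrable_bound[OF integrable_decay_weight])
      (auto intro!: AE_I2 simp: inverse_power_le_decay_weight[THEN order_trans] inverse_power_le_decay_weight)
  then show ?thesis
    using integrable_mult_right[of C] by fastforce
qed

lemma integrable_schwartz:
  fixes f :: "'b::euclidean_space \<Rightarrow> 'a::{banach, second_countable_topology}"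
  assumes "f \<in> schwartz"
  shows "integrable lborel f"
proof -
  obtain C where C: "\<And>x. norm (f x) \<le> C / (1 + (norm x)\<^sup>2) ^ DIM('b)"
    using schwartz_decay[OF assms] by blast
  have "f \<in> borel_measurable borel"
    using assms by (intro borel_measurable_continuous_onI schwartz_continuous)
  moreover have "norm (f x) \<le> norm (C / (1 + (norm x)\<^sup>2) ^ DIM('b))" for x
    using C[of x] abs_ge_self order_trans unfolding real_norm_def by blast
  ultimately show ?thesis
    by (intro Bochner_Integration.integrable_bound[OF integrable_inverse_power[of C]] AE_I2) auto
qed

text \<open>Difference quotients have integral zero by translation invariance; the decay of the derivative
  dominates them.\<close>

lemma integral_directional_derivative_eq_0:
  fixes f :: "'b::euclidean_space \<Rightarrow> 'a::{banach, second_countable_topology}"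
  assumes der: "\<And>x. (f has_derivative D x) (at x)"
    and e: "norm e \<le> 1"
    and f: "\<And>x. norm (f x) \<le> C / (1 + (norm x)\<^sup>2) ^ DIM('b)"
    and D: "\<And>x. norm (D x e) \<le> C' / (1 + (norm x)\<^sup>2) ^ DIM('b)"
  shows "(LINT x|lborel. D x e) = 0"
proof -
  define t where "t = (\<lambda>k. inverse (real (Suc k)))"
  have t: "0 < t k" "t k \<le> 1" for k
    by (auto simp: t_def field_simps)
  have "t \<longlonglongrightarrow> 0"
    unfolding t_def by (rule LIMSEQ_inverse_real_of_nat)
  define g where "g = (\<lambda>k x. inverse (t k) *\<^sub>R (f (x + t k *\<^sub>R e) - f x))"
  have cont: "continuous_on UNIV f"
    using der by (meson continuous_at_imp_continuous_on has_derivative_continuous)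
  then have [measurable]: "f \<in> borel_measurable borel"
    by (rule borel_measurable_continuous_onI)
  have C': "C' \<ge> 0"
    using order_trans[OF norm_ge_zero D[of 0]] by simp
  have lim: "(\<lambda>k. g k x) \<longlonglongrightarrow> D x e" for x
  proof -
    have "((\<lambda>s. x + s *\<^sub>R e) has_derivative (\<lambda>r. r *\<^sub>R e)) (at 0)"
      by (auto intro!: derivative_eq_intros)
    from has_derivative_compose[OF this, of f "D x"]
    have "((\<lambda>s. f (x + s *\<^sub>R e)) has_derivative (\<lambda>r. D x (r *\<^sub>R e))) (at 0)"
      using der[of x] by simp
    moreover have "(\<lambda>r. D x (r *\<^sub>R e)) = (\<lambda>r. r *\<^sub>R D x e)"
      using linear_cmul[OF has_derivative_linear[OF der]] by auto
    ultimately have "((\<lambda>s. norm (f (x + s *\<^sub>R e) - f x - s *\<^sub>R D x e) / norm s) \<longlongrightarrow> 0) (at 0)"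
      by (simp add: has_derivative_at)
    moreover have "norm (f (x + s *\<^sub>R e) - f x - s *\<^sub>R D x e) / norm s
        = norm (inverse s *\<^sub>R (f (x + s *\<^sub>R e) - f x) - D x e)" if "s \<noteq> 0" for s
    proof -
      have "inverse s *\<^sub>R (f (x + s *\<^sub>R e) - f x) - D x e
          = inverse s *\<^sub>R (f (x + s *\<^sub>R e) - f x - s *\<^sub>R D x e)"
        using that by (simp add: scaleR_right_diff_distrib)
      then show ?thesis
        by (simp add: divide_inverse mult.commute)
    qed
    ultimately have "((\<lambda>s. norm (inverse s *\<^sub>R (f (x + s *\<^sub>R e) - f x) - D x e)) \<longlongrightarrow> 0) (at 0)"
      by (subst tendsto_cong[symmetric]) (auto simp: eventually_at_filter elim!: tendsto_cong[THEN iffD1, rotated])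
    then have "((\<lambda>s. inverse s *\<^sub>R (f (x + s *\<^sub>R e) - f x)) \<longlongrightarrow> D x e) (at 0)"
      by (simp add: tendsto_norm_zero_iff LIM_zero_iff)
    moreover have "filterlim t (at 0) sequentially"
      using \<open>t \<longlonglongrightarrow> 0\<close> t(1) by (auto simp: filterlim_at less_imp_neq intro!: always_eventually) (metis less_irrefl)
    ultimately show ?thesis
      unfolding g_def by (rule filterlim_compose)
  qed
  \<comment> \<open>The quotient is controlled by the derivative on a segment of length at most 1. A
    shift that small changes 1 + |x|^2 by at most the factor 3, since |x|^2 \<le> 2|y|^2 + 2; hence
    the power of 3.\<close>
  have bound: "norm (g k x) \<le> (3 ^ DIM('b) * C') / (1 + (norm x)\<^sup>2) ^ DIM('b)" for k x
  proof -
    have cross: "u / v \<le> w / z" if "u * z \<le> w * v" "v > 0" "z > 0" for u v w z :: real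
      using that by (simp add: field_simps)
    define B where "B = (3 ^ DIM('b) * C') / (1 + (norm x)\<^sup>2) ^ DIM('b)"
    have DB: "norm (D (x + s *\<^sub>R e) e) \<le> B" if "s \<in> {0..t k}" for s
    proof -
      define y where "y = x + s *\<^sub>R e"
      have "norm (s *\<^sub>R e) \<le> 1"
        using that e t[of k] by (auto intro!: mult_le_one)
      then have "norm x \<le> norm y + 1"
        using norm_triangle_ineq4[of y "s *\<^sub>R e"] by (simp add: y_def)
      then have "(norm x)\<^sup>2 \<le> (norm y + 1)\<^sup>2"
        by (intro power_mono) auto
      also have "\<dots> \<le> 2 * (norm y)\<^sup>2 + 2"
        using zero_le_power2[of "norm y - 1"] by (simp add: power2_eq_square algebra_simps)
      finally have "1 + (norm x)\<^sup>2 \<le> 3 * (1 + (norm y)\<^sup>2)"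
        by (simp add: distrib_left) (use zero_le_power2[of "norm y"] in linarith)
      then have "(1 + (norm x)\<^sup>2) ^ DIM('b) \<le> 3 ^ DIM('b) * (1 + (norm y)\<^sup>2) ^ DIM('b)"
        by (metis power_mult_distrib power_mono add_nonneg_nonneg zero_le_one zero_le_power2)
      then have "C' * (1 + (norm x)\<^sup>2) ^ DIM('b) \<le> C' * (3 ^ DIM('b) * (1 + (norm y)\<^sup>2) ^ DIM('b))"
        using C' by (rule mult_left_mono)
      then have "C' / (1 + (norm y)\<^sup>2) ^ DIM('b) \<le> B"
        unfolding B_def by (intro cross) (simp_all add: mult_ac add_pos_nonneg)
      then show ?thesis
        using D[of y] by (simp add: y_def)
    qed
    have "norm (f (x + t k *\<^sub>R e) - f (x + 0 *\<^sub>R e)) \<le> B * norm (t k - 0)"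
    proof (rule differentiable_bound[of "{0..t k}" "\<lambda>s. f (x + s *\<^sub>R e)" "\<lambda>s r. D (x + s *\<^sub>R e) (r *\<^sub>R e)"])
      fix s assume s: "s \<in> {0..t k}"
      have "((\<lambda>s. x + s *\<^sub>R e) has_derivative (\<lambda>r. r *\<^sub>R e)) (at s within {0..t k})"
        by (auto intro!: derivative_eq_intros)
      from has_derivative_compose[OF this der]
      show "((\<lambda>s. f (x + s *\<^sub>R e)) has_derivative (\<lambda>r. D (x + s *\<^sub>R e) (r *\<^sub>R e))) (at s within {0..t k})" .
      show "onorm (\<lambda>r. D (x + s *\<^sub>R e) (r *\<^sub>R e)) \<le> B"
        using DB[OF s] order_trans[OF norm_ge_zero DB[OF s]]
        by (intro onorm_bound)
          (auto simp: linear_cmul[OF has_derivative_linear[OF der]] mult.commute[of B] intro: mult_left_mono)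
    qed (use t[of k] in auto)
    moreover have "norm (g k x) = norm (f (x + t k *\<^sub>R e) - f (x + 0 *\<^sub>R e)) / t k"
      using t[of k] by (simp add: g_def divide_inverse mult.commute)
    ultimately show ?thesis
      using t[of k] unfolding B_def[symmetric] by (simp add: pos_divide_le_eq)
  qed
  have int: "integrable lborel f"
    using order_trans[OF f abs_ge_self]
    by (intro Bochner_Integration.integrable_bound[OF integrable_inverse_power[of C]] AE_I2) auto
  have "(LINT x|lborel. g k x) = 0" for k
  proof -
    have "integrable lborel (\<lambda>x. f (t k *\<^sub>R e + x))"
      using integrable_lborel_affine[OF _ int, of 1] by simp
    then show ?thesis
      using int integral_lborel_translate[of f "t k *\<^sub>R e"]
      by (simp add: g_def add.commute)
  qed
  moreover have "(\<lambda>k. LINT x|lborel. g k x) \<longlonglongrightarrow> (LINT x|lborel. D x e)"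
  proof (rule integral_dominated_convergence)
    have [measurable]: "g k \<in> borel_measurable borel" for k
      unfolding g_def by measurable
    show "(\<lambda>x. D x e) \<in> borel_measurable lborel"
      using borel_measurable_LIMSEQ_metric[of g lborel "\<lambda>x. D x e"] lim by simp
    show "g k \<in> borel_measurable lborel" for k
      by simp
  qed (use integrable_inverse_power[of "3 ^ DIM('b) * C'"] lim bound in auto)
  ultimately show ?thesis
    by (simp add: LIMSEQ_const_iff)
qed

section \<open>Gaussians\<close>

text \<open>Here s is an inverse width: as s tends to 0 the function flattens and its Fourier
  transform narrows. The frequency is q and the centre of the modulus is x0; the phase is not
  recentred.\<close>

definition gaussian :: "real \<Rightarrow> 'b \<Rightarrow> 'b \<Rightarrow> 'b::euclidean_space \<Rightarrow> complex" where
  "gaussian s q x0 x = cis (q \<bullet> x) * of_real (exp (- s\<^sup>2 * (norm (x - x0))\<^sup>2 / 2))"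

lemma gaussian_has_derivative:
  "(gaussian s q x0 has_derivative
     (\<lambda>h. (\<i> * of_real (q \<bullet> h) - of_real (s\<^sup>2 * ((x - x0) \<bullet> h))) * gaussian s q x0 x)) (at x)"
proof -
  have eq: "gaussian s q x0 = (\<lambda>x. exp (\<i> * of_real (q \<bullet> x) - of_real (s\<^sup>2 / 2 * ((x - x0) \<bullet> (x - x0)))))"
  proof
    fix x
    have "exp (z - of_real w) = exp z * of_real (exp (- w))" for z :: complex and w :: real
      by (metis exp_add exp_of_real of_real_minus diff_conv_add_uminus)
    moreover have "- s\<^sup>2 * (norm (x - x0))\<^sup>2 / 2 = - (s\<^sup>2 / 2 * ((x - x0) \<bullet> (x - x0)))"
      by (simp add: power2_norm_eq_inner)
    ultimately show "gaussian s q x0 x = exp (\<i> * of_real (q \<bullet> x) - of_real (s\<^sup>2 / 2 * ((x - x0) \<bullet> (x - x0))))"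
      by (metis gaussian_def cis_conv_exp)
  qed
  define Q where "Q = (\<lambda>x. \<i> * of_real (q \<bullet> x) - of_real (s\<^sup>2 / 2 * ((x - x0) \<bullet> (x - x0))) :: complex)"
  have "(Q has_derivative (\<lambda>h. \<i> * of_real (q \<bullet> h) - of_real (s\<^sup>2 / 2 * ((x - x0) \<bullet> h + h \<bullet> (x - x0))))) (at x)"
    unfolding Q_def by (auto intro!: derivative_eq_intros)
  moreover have "s\<^sup>2 / 2 * ((x - x0) \<bullet> h + h \<bullet> (x - x0)) = s\<^sup>2 * ((x - x0) \<bullet> h)" for h
    by (simp add: inner_commute[of h])
  ultimately have Q: "(Q has_derivative (\<lambda>h. \<i> * of_real (q \<bullet> h) - of_real (s\<^sup>2 * ((x - x0) \<bullet> h)))) (at x)"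
    by (simp only:)
  have "(exp has_derivative (*) (exp (Q x))) (at (Q x))"
    using DERIV_exp[of "Q x"] by (simp add: has_field_derivative_def)
  from has_derivative_compose[OF Q this] show ?thesis
    unfolding eq by (simp add: Q_def mult.commute)
qed

text \<open>The products of a polynomial with E, generated by closure rules. For a Gaussian E this
  set is stable under partial derivatives, as \<open>schwartz_coinduct\<close> demands.\<close>

inductive_set poly_multiples :: "('b::euclidean_space \<Rightarrow> complex) \<Rightarrow> ('b \<Rightarrow> complex) set" for E where
  base: "E \<in> poly_multiples E"
| add: "f \<in> poly_multiples E \<Longrightarrow> g \<in> poly_multiples E \<Longrightarrow> (\<lambda>x. f x + g x) \<in> poly_multiples E"
| scale: "f \<in> poly_multiples E \<Longrightarrow> (\<lambda>x. c * f x) \<in> poly_multiples E"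
| coord: "f \<in> poly_multiples E \<Longrightarrow> b \<in> Basis \<Longrightarrow> (\<lambda>x. of_real (x \<bullet> b) * f x) \<in> poly_multiples E"

text \<open>The exponent of a Gaussian is quadratic, so each partial derivative multiplies it by an
  affine function of x; the product rule takes care of further coordinate factors.\<close>

lemma poly_multiples_gaussian_derivative:
  assumes "f \<in> poly_multiples (gaussian s q x0)"
  shows "\<exists>D. (\<forall>x. (f has_derivative D x) (at x)) \<and>
    (\<forall>b\<in>Basis. (\<lambda>x. D x b) \<in> poly_multiples (gaussian s q x0))"
  using assms
proof induction
  case base
  let ?E = "gaussian s q x0"
  have "(\<lambda>x. (\<i> * of_real (q \<bullet> b) - of_real (s\<^sup>2 * ((x - x0) \<bullet> b))) * ?E x) \<in> poly_multiples ?E"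
    if b: "b \<in> Basis" for b
  proof -
    have "(\<lambda>x. (\<i> * of_real (q \<bullet> b) + of_real (s\<^sup>2 * (x0 \<bullet> b))) * ?E x
        + - of_real (s\<^sup>2) * (of_real (x \<bullet> b) * ?E x)) \<in> poly_multiples ?E"
      using b by (intro poly_multiples.intros)
    also have "(\<lambda>x. (\<i> * of_real (q \<bullet> b) + of_real (s\<^sup>2 * (x0 \<bullet> b))) * ?E x
        + - of_real (s\<^sup>2) * (of_real (x \<bullet> b) * ?E x))
      = (\<lambda>x. (\<i> * of_real (q \<bullet> b) - of_real (s\<^sup>2 * ((x - x0) \<bullet> b))) * ?E x)"
      by (simp add: fun_eq_iff algebra_simps inner_diff_left)
    finally show ?thesis .
  qed
  with gaussian_has_derivative show ?case
    by (intro exI[of _ "\<lambda>x h. (\<i> * of_real (q \<bullet> h) - of_real (s\<^sup>2 * ((x - x0) \<bullet> h))) * ?E x"] conjI allI ballI)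
next
  case (add f g)
  then obtain D D' where "\<forall>x. (f has_derivative D x) (at x)" "\<forall>x. (g has_derivative D' x) (at x)"
    "\<forall>b\<in>Basis. (\<lambda>x. D x b) \<in> poly_multiples (gaussian s q x0)"
    "\<forall>b\<in>Basis. (\<lambda>x. D' x b) \<in> poly_multiples (gaussian s q x0)"
    by blast
  then show ?case
    by (intro exI[of _ "\<lambda>x h. D x h + D' x h"])
      (auto intro!: poly_multiples.add has_derivative_add)
next
  case (scale f c)
  then obtain D where "\<forall>x. (f has_derivative D x) (at x)"
    "\<forall>b\<in>Basis. (\<lambda>x. D x b) \<in> poly_multiples (gaussian s q x0)"
    by blast
  then show ?case
    by (intro exI[of _ "\<lambda>x h. c * D x h"])
      (auto intro!: poly_multiples.scale has_derivative_mult_right)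
next
  case (coord f b)
  then obtain D where D: "\<And>x. (f has_derivative D x) (at x)"
    "\<And>c. c \<in> Basis \<Longrightarrow> (\<lambda>x. D x c) \<in> poly_multiples (gaussian s q x0)"
    by blast
  have "((\<lambda>x. of_real (x \<bullet> b) * f x) has_derivative
      (\<lambda>h. of_real (h \<bullet> b) * f x + of_real (x \<bullet> b) * D x h)) (at x)" for x
    using D(1) by (auto intro!: derivative_eq_intros)
  moreover have "(\<lambda>x. of_real (c \<bullet> b) * f x + of_real (x \<bullet> b) * D x c)
      \<in> poly_multiples (gaussian s q x0)" if "c \<in> Basis" for c
    using coord D(2)[OF that] by (intro poly_multiples.add poly_multiples.scale poly_multiples.coord)
  ultimately show ?case
    by (intro exI[of _ "\<lambda>x h. of_real (h \<bullet> b) * f x + of_real (x \<bullet> b) * D x h"]) auto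
qed

lemma power_le_exp: "\<exists>C. \<forall>z\<ge>0. z ^ k \<le> C * exp (z :: real)"
proof (cases "k = 0")
  case False
  have "z ^ k \<le> real k ^ k * exp z" if "z \<ge> 0" for z :: real
  proof -
    have "(z / real k) ^ k \<le> (1 + z / real k) ^ k"
      using that by (intro power_mono) auto
    also have "\<dots> \<le> exp z"
      using that False by (intro exp_ge_one_plus_x_over_n_power_n) auto
    finally show ?thesis
      using False by (simp add: power_divide field_simps)
  qed
  then show ?thesis
    by blast
qed (auto intro!: exI[of _ 1])

text \<open>The power is traded for exp(s|x|), and |x| \<le> y + |x0| with y = |x - x0|. Completing
  the square gives s y - s^2 y^2 / 2 \<le> 1/2, the source of the 1/2 in the constant.\<close>

lemma gaussian_decay:
  assumes "s > 0"
  shows "\<exists>C. \<forall>x. norm x ^ k * norm (gaussian s q x0 x) \<le> C"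
proof -
  obtain C where C: "\<And>z. z \<ge> 0 \<Longrightarrow> z ^ k \<le> C * exp (z :: real)"
    using power_le_exp by blast
  have "norm x ^ k * norm (gaussian s q x0 x) \<le> C * exp (s * norm x0 + 1 / 2) / s ^ k" for x
  proof -
    define y where "y = norm (x - x0)"
    have "C \<ge> 0"
      using order_trans[OF zero_le_one C[of 1, simplified]] by (simp add: zero_le_mult_iff)
    have "(s * norm x) ^ k \<le> C * exp (s * norm x)"
      using assms by (intro C) auto
    also have "\<dots> \<le> C * exp (s * y + s * norm x0)"
      using assms norm_triangle_sub[of x x0] \<open>C \<ge> 0\<close>
      by (intro mult_left_mono) (auto simp: y_def add.commute simp flip: distrib_left)
    finally have "(s * norm x) ^ k * exp (- s\<^sup>2 * y\<^sup>2 / 2) \<le> C * exp (s * y + s * norm x0) * exp (- s\<^sup>2 * y\<^sup>2 / 2)"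
      by (rule mult_right_mono) simp
    also have "\<dots> = C * exp (s * y + s * norm x0 - s\<^sup>2 * y\<^sup>2 / 2)"
      by (simp flip: exp_add add: mult.assoc)
    also have "\<dots> \<le> C * exp (s * norm x0 + 1 / 2)"
    proof -
      have "s * y \<le> s\<^sup>2 * y\<^sup>2 / 2 + 1 / 2"
        using zero_le_power2[of "s * y - 1"] by (simp add: power2_eq_square algebra_simps)
      then show ?thesis
        using \<open>C \<ge> 0\<close> by (intro mult_left_mono) auto
    qed
    finally show ?thesis
      using assms by (simp add: gaussian_def norm_mult y_def power_mult_distrib field_simps)
  qed
  then show ?thesis
    by blast
qed

text \<open>A coordinate factor costs one more power of |x|, so the induction has to run for all k
  simultaneously.\<close>

lemma poly_multiples_decay:
  assumes "f \<in> poly_multiples E" and E: "\<And>k. \<exists>C. \<forall>x. norm x ^ k * norm (E x) \<le> C"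
  shows "\<exists>C. \<forall>x. norm x ^ k * norm (f x) \<le> C"
  using assms(1)
proof (induction arbitrary: k)
  case (add f g)
  obtain C C' where "\<forall>x. norm x ^ k * norm (f x) \<le> C" "\<forall>x. norm x ^ k * norm (g x) \<le> C'"
    using add.IH[of k] by blast
  then have "norm x ^ k * norm (f x + g x) \<le> C + C'" for x
    using mult_left_mono[OF norm_triangle_ineq[of "f x" "g x"], of "norm x ^ k"]
    by (simp add: distrib_left) (smt (verit))
  then show ?case by blast
next
  case (scale f c)
  obtain C where "\<forall>x. norm x ^ k * norm (f x) \<le> C"
    using scale.IH[of k] by blast
  then have "norm x ^ k * norm (c * f x) \<le> norm c * C" for x
    by (simp add: norm_mult mult.left_commute mult_left_mono)
  then show ?case by blast
next
  case (coord f b)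
  obtain C where C: "\<forall>x. norm x ^ Suc k * norm (f x) \<le> C"
    using coord.IH[of "Suc k"] by blast
  have "norm x ^ k * norm (of_real (x \<bullet> b) * f x) \<le> C" for x
  proof -
    have "norm x ^ k * norm (of_real (x \<bullet> b) * f x) = \<bar>x \<bullet> b\<bar> * (norm x ^ k * norm (f x))"
      by (simp add: norm_mult)
    also have "\<dots> \<le> norm x * (norm x ^ k * norm (f x))"
      using Basis_le_norm[OF coord.hyps(2)] by (intro mult_right_mono) auto
    also have "\<dots> \<le> C"
      using C by (simp add: mult_ac)
    finally show ?thesis .
  qed
  then show ?case by blast
qed (rule E)

lemma schwartz_gaussian:
  assumes "s > 0"
  shows "gaussian s q x0 \<in> schwartz"
proof (rule schwartz_coinduct[OF poly_multiples.base])
  fix f :: "'a \<Rightarrow> complex" assume f: "f \<in> poly_multiples (gaussian s q x0)"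
  then obtain D where D: "\<And>x. (f has_derivative D x) (at x)"
    "\<And>c. c \<in> Basis \<Longrightarrow> (\<lambda>x. D x c) \<in> poly_multiples (gaussian s q x0)"
    using poly_multiples_gaussian_derivative by blast
  show "f differentiable (at x)" for x
    using D(1) by (rule differentiableI)
  show "bounded (range (\<lambda>x. norm x ^ k *\<^sub>R f x))" for k
    using poly_multiples_decay[OF f gaussian_decay[OF assms], of k] by (auto simp: bounded_iff)
  show "(\<lambda>x. frechet_derivative f (at x) b) \<in> poly_multiples (gaussian s q x0)" if "b \<in> Basis" for b
    using D(2)[OF that] frechet_derivative_at[OF D(1)] by simp
qed

text \<open>L commutes with differentiation, so the image of the Schwartz space under composition
  with L is itself closed under partial derivatives.\<close>

lemma schwartz_bounded_linear:
  assumes "f \<in> schwartz" and L: "bounded_linear L"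
  shows "(\<lambda>x. L (f x)) \<in> schwartz"
proof (rule schwartz_coinduct[where S = "(\<lambda>f x. L (f x)) ` schwartz"])
  fix g assume "g \<in> (\<lambda>f x. L (f x)) ` schwartz"
  then obtain h where h: "h \<in> schwartz" and g: "g = (\<lambda>x. L (h x))"
    by blast
  have D: "(g has_derivative (\<lambda>v. L (frechet_derivative h (at x) v))) (at x)" for x
    unfolding g by (rule bounded_linear.has_derivative[OF L schwartz_has_derivative[OF h]])
  show "g differentiable (at x)" for x
    using D by (rule differentiableI)
  show "bounded (range (\<lambda>x. norm x ^ k *\<^sub>R g x))" for k
  proof -
    have "bounded (range (\<lambda>x. norm x ^ k *\<^sub>R iter_partial [] h x))"
      using h unfolding schwartz_def by blast
    then have "bounded (L ` range (\<lambda>x. norm x ^ k *\<^sub>R h x))"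
      using bounded_linear_image[OF _ L] by simp
    also have "L ` range (\<lambda>x. norm x ^ k *\<^sub>R h x) = range (\<lambda>x. norm x ^ k *\<^sub>R g x)"
      using bounded_linear.linear[OF L] by (auto simp: g image_image linear_cmul)
    finally show ?thesis .
  qed
  show "(\<lambda>x. frechet_derivative g (at x) b) \<in> (\<lambda>f x. L (f x)) ` schwartz" if "b \<in> Basis" for b
    by (rule image_eqI[OF _ schwartz_partial[OF h that]]) (simp flip: frechet_derivative_at[OF D])
qed (use assms(1) in blast)

lemma schwartz_scaleC:
  fixes d :: "'a::complex_banach"
  assumes "f \<in> schwartz"
  shows "(\<lambda>x. f x *\<^sub>C d) \<in> schwartz"
  by (rule schwartz_bounded_linear[OF assms scaleC.bounded_linear_left])

section \<open>Gaussian averages and Fourier integrals\<close>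

text \<open>Substituting x = x0 + t y fixes the weight and moves the parameter into H(x0 + t y),
  which tends to H(x0). Dominated convergence leaves H(x0) times the mass of the weight, and that
  mass is nonzero.\<close>

lemma eq_0_if_gaussian_averages_eq_0:
  fixes H :: "'b::euclidean_space \<Rightarrow> 'a::{banach, second_countable_topology}"
  assumes cont: "continuous_on UNIV H" and bound: "\<And>x. norm (H x) \<le> B"
    and avg: "\<And>s::real. s > 0 \<Longrightarrow> (LINT x|lborel. exp (- (norm (x - x0))\<^sup>2 / (2 * s\<^sup>2)) *\<^sub>R H x) = 0"
  shows "H x0 = 0"
proof -
  define t where "t = (\<lambda>k. inverse (real (Suc k)))"
  have t: "0 < t k" for k
    by (auto simp: t_def)
  have "t \<longlonglongrightarrow> 0"
    unfolding t_def by (rule LIMSEQ_inverse_real_of_nat)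
  have [measurable]: "H \<in> borel_measurable borel"
    using cont by (rule borel_measurable_continuous_onI)
  have int: "integrable lborel (\<lambda>x::'b. exp (- (norm x)\<^sup>2 / 2))"
  proof (rule Bochner_Integration.integrable_bound)
    show "integrable lborel (gaussian 1 0 0 :: 'b \<Rightarrow> complex)"
      by (intro integrable_schwartz schwartz_gaussian) simp
  qed (auto simp: gaussian_def norm_mult)
  have "(LINT x|lborel. exp (- (norm x)\<^sup>2 / 2) *\<^sub>R H (x0 + t k *\<^sub>R x)) = 0" for k
  proof -
    have "0 = (LINT x|lborel. exp (- (norm (x - x0))\<^sup>2 / (2 * (t k)\<^sup>2)) *\<^sub>R H x)"
      using avg[OF t] by simp
    also have "\<dots> = \<bar>t k\<bar> ^ DIM('b) *\<^sub>R (LINT x|lborel. exp (- (norm (x0 + t k *\<^sub>R x - x0))\<^sup>2 / (2 * (t k)\<^sup>2))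
        *\<^sub>R H (x0 + t k *\<^sub>R x))"
      using t[of k] by (intro integral_lborel_affine) auto
    also have "\<dots> = \<bar>t k\<bar> ^ DIM('b) *\<^sub>R (LINT x|lborel. exp (- (norm x)\<^sup>2 / 2) *\<^sub>R H (x0 + t k *\<^sub>R x))"
      using t[of k] by (simp add: power_mult_distrib)
    finally show ?thesis
      using t[of k] by simp
  qed
  moreover have "(\<lambda>k. LINT x|lborel. exp (- (norm x)\<^sup>2 / 2) *\<^sub>R H (x0 + t k *\<^sub>R x)) \<longlonglongrightarrow>
      (LINT x::'b|lborel. exp (- (norm x)\<^sup>2 / 2) *\<^sub>R H x0)"
  proof (rule integral_dominated_convergence[where w = "\<lambda>x. exp (- (norm x)\<^sup>2 / 2) * B"])
    have "isCont H x0"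
      using cont by (simp add: continuous_on_eq_continuous_at)
    moreover have "(\<lambda>k. x0 + t k *\<^sub>R x) \<longlonglongrightarrow> x0" for x
      using tendsto_add[OF tendsto_const tendsto_scaleR[OF \<open>t \<longlonglongrightarrow> 0\<close> tendsto_const], of x0 x] by simp
    ultimately have "(\<lambda>k. H (x0 + t k *\<^sub>R x)) \<longlonglongrightarrow> H x0" for x
      by (rule isCont_tendsto_compose)
    then show "AE x in lborel. (\<lambda>k. exp (- (norm x)\<^sup>2 / 2) *\<^sub>R H (x0 + t k *\<^sub>R x)) \<longlonglongrightarrow>
        exp (- (norm x)\<^sup>2 / 2) *\<^sub>R H x0"
      by (intro AE_I2 tendsto_intros)
    show "integrable lborel (\<lambda>x::'b. exp (- (norm x)\<^sup>2 / 2) * B)"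
      using int by simp
    show "AE x in lborel. norm (exp (- (norm x)\<^sup>2 / 2) *\<^sub>R H (x0 + t k *\<^sub>R x)) \<le> exp (- (norm x)\<^sup>2 / 2) * B" for k
      using bound by (intro AE_I2) (simp add: mult_left_mono)
  qed measurable
  ultimately have "(LINT x::'b|lborel. exp (- (norm x)\<^sup>2 / 2)) *\<^sub>R H x0 = 0"
    using int LIMSEQ_unique[OF _ tendsto_const] by (simp add: LIMSEQ_const_iff)
  moreover have "(LINT x::'b|lborel. exp (- (norm x)\<^sup>2 / 2)) \<noteq> 0"
    using int by (simp add: integral_nonneg_eq_0_iff_AE eventually_False ae_filter_eq_bot_iff)
  ultimately show ?thesis
    by simp
qed

text \<open>This is the characteristic function of the standard normal distribution at t / s, after
  the substitution x = s y.\<close>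

lemma integral_cis_gaussian_real:
  assumes s: "s > 0"
  shows "integrable lborel (\<lambda>y. cis (t * y) * of_real (exp (- s\<^sup>2 * y\<^sup>2 / 2)))" (is ?A)
    and "(LINT y|lborel. cis (t * y) * of_real (exp (- s\<^sup>2 * y\<^sup>2 / 2))) =
      of_real (sqrt (2 * pi) / s * exp (- t\<^sup>2 / (2 * s\<^sup>2)))" (is ?B)
proof -
  have eq: "cis (t * y) * of_real (exp (- s\<^sup>2 * y\<^sup>2 / 2)) = gaussian s t 0 y" for y
    by (simp add: gaussian_def)
  show ?A
    unfolding eq by (intro integrable_schwartz schwartz_gaussian s)
  have "of_real (exp (- (t / s)\<^sup>2 / 2)) = (CLINT x|std_normal_distribution. iexp ((t / s) * x))"
    using char_std_normal_distribution unfolding char_def by metis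
  also have "\<dots> = (CLINT x|lborel. std_normal_density x *\<^sub>R iexp ((t / s) * x))"
    by (subst integral_density) (auto simp: normal_density_nonneg)
  also have "\<dots> = \<bar>s\<bar> *\<^sub>R (CLINT x|lborel. std_normal_density (0 + s * x) *\<^sub>R iexp ((t / s) * (0 + s * x)))"
    using s by (intro lborel_integral_real_affine) auto
  also have "(\<lambda>x. std_normal_density (0 + s * x) *\<^sub>R iexp ((t / s) * (0 + s * x)))
      = (\<lambda>x. (1 / sqrt (2 * pi)) *\<^sub>R (cis (t * x) * of_real (exp (- s\<^sup>2 * x\<^sup>2 / 2))))"
    using s by (simp add: fun_eq_iff std_normal_density_def cis_conv_exp scaleR_conv_of_real power_mult_distrib)
  finally have "of_real (exp (- (t / s)\<^sup>2 / 2)) =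
      \<bar>s\<bar> *\<^sub>R (1 / sqrt (2 * pi)) *\<^sub>R (LINT y|lborel. cis (t * y) * of_real (exp (- s\<^sup>2 * y\<^sup>2 / 2)) :: complex)"
    by simp
  then show ?B
    using s by (simp add: scaleR_conv_of_real field_simps power_divide)
qed

lemma integral_cis_gaussian:
  fixes \<eta> :: "'b::euclidean_space"
  assumes s: "s > 0"
  shows "(LINT x|lborel. cis (\<eta> \<bullet> x) * of_real (exp (- s\<^sup>2 * (norm x)\<^sup>2 / 2))) =
      of_real ((sqrt (2 * pi) / s) ^ DIM('b) * exp (- (norm \<eta>)\<^sup>2 / (2 * s\<^sup>2)))"
proof -
  have sq: "(norm x)\<^sup>2 = (\<Sum>b\<in>Basis. (x \<bullet> b)\<^sup>2)" for x :: 'b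
    unfolding power2_norm_eq_inner by (subst euclidean_inner) (simp add: power2_eq_square)
  have cis_sum: "cis (sum f A) = (\<Prod>a\<in>A. cis (f a))" if "finite A" for f and A :: "'b set"
    using that by induction (auto simp flip: cis_mult)
  have "cis (\<eta> \<bullet> x) * of_real (exp (- s\<^sup>2 * (norm x)\<^sup>2 / 2)) =
      (\<Prod>b\<in>Basis. cis ((\<eta> \<bullet> b) * (x \<bullet> b)) * of_real (exp (- s\<^sup>2 * (x \<bullet> b)\<^sup>2 / 2)))" for x
  proof -
    have "cis (\<eta> \<bullet> x) = (\<Prod>b\<in>Basis. cis ((\<eta> \<bullet> b) * (x \<bullet> b)))"
      by (subst euclidean_inner) (simp add: cis_sum)
    moreover have "exp (- s\<^sup>2 * (norm x)\<^sup>2 / 2) = (\<Prod>b\<in>Basis. exp (- s\<^sup>2 * (x \<bullet> b)\<^sup>2 / 2))"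
      unfolding sq by (simp add: sum_distrib_left sum_negf sum_divide_distrib flip: exp_sum)
    ultimately show ?thesis
      by (simp add: prod.distrib)
  qed
  then have "(LINT x|lborel. cis (\<eta> \<bullet> x) * of_real (exp (- s\<^sup>2 * (norm x)\<^sup>2 / 2)))
    = (\<Prod>b\<in>Basis. (LINT t|lborel. cis ((\<eta> \<bullet> b) * t) * of_real (exp (- s\<^sup>2 * t\<^sup>2 / 2))))"
    by (simp only:) (rule integral_lborel_Basis_prod, rule integral_cis_gaussian_real(1)[OF s])
  also have "\<dots> = of_real ((sqrt (2 * pi) / s) ^ DIM('b) * (\<Prod>b\<in>Basis. exp (- (\<eta> \<bullet> b)\<^sup>2 / (2 * s\<^sup>2))))"
    unfolding integral_cis_gaussian_real(2)[OF s] of_real_prod[symmetric] prod.distrib by simp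
  also have "(\<Prod>b\<in>Basis. exp (- (\<eta> \<bullet> b)\<^sup>2 / (2 * s\<^sup>2))) = exp (- (norm \<eta>)\<^sup>2 / (2 * s\<^sup>2))"
    unfolding sq by (simp add: sum_negf sum_divide_distrib flip: exp_sum)
  finally show ?thesis .
qed

lemma integral_scaleC_left:
  fixes d :: "'a::separable_cstar_algebra"
  assumes "integrable M f"
  shows "(LINT x|M. f x *\<^sub>C d) = (LINT x|M. f x) *\<^sub>C d"
  by (rule integral_bounded_linear[OF scaleC.bounded_linear_left assms])

text \<open>Holds for arbitrary integrands: scaling by a nonzero c has a bounded inverse, so both
  sides are integrable together or both take the default value 0.\<close>

lemma integral_scaleC_right:
  fixes f :: "_ \<Rightarrow> 'a::separable_cstar_algebra"
  shows "(LINT x|M. c *\<^sub>C f x) = c *\<^sub>C (LINT x|M. f x)"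
proof (cases "c = 0")
  case False
  show ?thesis
  proof (rule integral_bounded_linear'[OF scaleC.bounded_linear_right])
    show "bounded_linear (\<lambda>x :: 'a. inverse c *\<^sub>C x)"
      by (rule scaleC.bounded_linear_right)
    show "\<forall>x :: 'a. inverse c *\<^sub>C (c *\<^sub>C x) = x"
      using False by (simp add: scaleC_scaleC scaleC_one)
  qed
qed (simp add: scaleC.zero_left)

section \<open>Oscillatory integrals\<close>

text \<open>The regularised integrand after v = y - x, with the left factor, which depends on u
  only, taken out. In the variable y a derivative falls on \<phi> itself.\<close>

definition osc_kernel ::
  "'b::euclidean_space \<Rightarrow> ('b \<times> 'b \<Rightarrow> complex) \<Rightarrow> ('b \<Rightarrow> 'a) \<Rightarrow> real \<Rightarrow> 'b \<Rightarrow> 'b \<Rightarrow> 'a::complex_banach" where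
  "osc_kernel x \<psi> \<phi> \<epsilon> u y = (cis (u \<bullet> (y - x)) * \<psi> (\<epsilon> *\<^sub>R u, \<epsilon> *\<^sub>R (y - x))) *\<^sub>C \<phi> y"

lemma continuous_osc_kernel:
  assumes "\<psi> \<in> schwartz" "\<phi> \<in> schwartz"
  shows "continuous_on UNIV (osc_kernel x \<psi> \<phi> \<epsilon> u)"
    "continuous_on UNIV (\<lambda>(u, y). osc_kernel x \<psi> \<phi> \<epsilon> u y)"
proof -
  note [continuous_intros] =
    continuous_on_compose2[OF schwartz_continuous[OF assms(1), of UNIV] _ subset_UNIV]
    continuous_on_compose2[OF schwartz_continuous[OF assms(2), of UNIV] _ subset_UNIV]
  show "continuous_on UNIV (osc_kernel x \<psi> \<phi> \<epsilon> u)"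
    unfolding osc_kernel_def by (intro continuous_intros)
  show "continuous_on UNIV (\<lambda>(u, y). osc_kernel x \<psi> \<phi> \<epsilon> u y)"
    unfolding osc_kernel_def split_beta by (intro continuous_intros)
qed

lemma osc_kernel_bound:
  assumes "\<And>z. norm (\<psi> z) \<le> C"
  shows "norm (osc_kernel x \<psi> \<phi> \<epsilon> u y) \<le> C * norm (\<phi> y)"
  unfolding osc_kernel_def using assms
  by (simp add: norm_scaleC norm_mult mult_right_mono)

lemma integrable_osc_kernel:
  fixes \<phi> :: "_ \<Rightarrow> 'a::separable_cstar_algebra"
  assumes "\<psi> \<in> schwartz" "\<phi> \<in> schwartz"
  shows "integrable lborel (osc_kernel x \<psi> \<phi> \<epsilon> u)"
proof -
  obtain C where C: "C \<ge> 0" "\<And>z. norm (\<psi> z) \<le> C"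
    using schwartz_bounded[OF assms(1)] by blast
  show ?thesis
  proof (rule Bochner_Integration.integrable_bound)
    show "integrable lborel (\<lambda>y. C * norm (\<phi> y))"
      using integrable_schwartz[OF assms(2)] by simp
    show "osc_kernel x \<psi> \<phi> \<epsilon> u \<in> borel_measurable lborel"
      using borel_measurable_continuous_onI[OF continuous_osc_kernel(1)[OF assms]] by simp
    show "AE y in lborel. norm (osc_kernel x \<psi> \<phi> \<epsilon> u y) \<le> norm (C * norm (\<phi> y))"
      using order_trans[OF osc_kernel_bound[of \<psi>, OF C(2)] abs_ge_self] by (intro AE_I2) simp
  qed
qed

text \<open>The derivative of the kernel along b has total integral 0 and consists of three terms,
  from the phase, the cut-off and \<phi>. The cut-off term carries a factor \<epsilon>. The
  remaining integrals are again of kernel type, so the identity can be iterated.\<close>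

lemma osc_kernel_by_parts:
  fixes \<phi> :: "'b::euclidean_space \<Rightarrow> 'a::separable_cstar_algebra"
  assumes \<psi>: "\<psi> \<in> schwartz" and \<phi>: "\<phi> \<in> schwartz" and b: "b \<in> Basis"
  defines "\<psi>' \<equiv> \<lambda>z. frechet_derivative \<psi> (at z) (0, b)"
    and "\<phi>' \<equiv> \<lambda>y. frechet_derivative \<phi> (at y) b"
  shows "(\<i> * of_real (u \<bullet> b)) *\<^sub>C (LINT y|lborel. osc_kernel x \<psi> \<phi> \<epsilon> u y) =
    - (\<epsilon> *\<^sub>R (LINT y|lborel. osc_kernel x \<psi>' \<phi> \<epsilon> u y) + (LINT y|lborel. osc_kernel x \<psi> \<phi>' \<epsilon> u y))"
proof -
  have b': "(0, b) \<in> Basis"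
    using b by (simp add: Basis_prod_def)
  have \<psi>': "\<psi>' \<in> schwartz" and \<phi>': "\<phi>' \<in> schwartz"
    unfolding \<psi>'_def \<phi>'_def by (intro schwartz_partial \<psi> \<phi> b b')+
  define D where "D = (\<lambda>y h.
      (cis (u \<bullet> (y - x)) * \<psi> (\<epsilon> *\<^sub>R u, \<epsilon> *\<^sub>R (y - x))) *\<^sub>C frechet_derivative \<phi> (at y) h +
      (cis (u \<bullet> (y - x)) * frechet_derivative \<psi> (at (\<epsilon> *\<^sub>R u, \<epsilon> *\<^sub>R (y - x))) (0, \<epsilon> *\<^sub>R h) +
       (\<i> * of_real (u \<bullet> h)) * cis (u \<bullet> (y - x)) * \<psi> (\<epsilon> *\<^sub>R u, \<epsilon> *\<^sub>R (y - x))) *\<^sub>C \<phi> y)"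
  have D_b: "D y b = osc_kernel x \<psi> \<phi>' \<epsilon> u y + (\<epsilon> *\<^sub>R osc_kernel x \<psi>' \<phi> \<epsilon> u y
      + (\<i> * of_real (u \<bullet> b)) *\<^sub>C osc_kernel x \<psi> \<phi> \<epsilon> u y)" for y
  proof -
    have "frechet_derivative \<psi> (at z) (0, \<epsilon> *\<^sub>R b) = \<epsilon> *\<^sub>R \<psi>' z" for z
      using linear_cmul[OF has_derivative_linear[OF schwartz_has_derivative[OF \<psi>]], of z \<epsilon> "(0, b)"]
      by (simp add: \<psi>'_def)
    then show ?thesis
      by (simp add: D_def osc_kernel_def \<phi>'_def scaleC_add_left scaleC_scaleC scaleR_scaleC_left mult.assoc)
  qed
  have der: "(osc_kernel x \<psi> \<phi> \<epsilon> u has_derivative D y) (at y)" for y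
  proof -
    have 1: "((\<lambda>y. (\<epsilon> *\<^sub>R u, \<epsilon> *\<^sub>R (y - x))) has_derivative (\<lambda>h. (0, \<epsilon> *\<^sub>R h))) (at y)"
      by (auto intro!: derivative_eq_intros)
    have 2: "((\<lambda>y. cis (u \<bullet> (y - x))) has_derivative (\<lambda>h. (\<i> * of_real (u \<bullet> h)) * cis (u \<bullet> (y - x)))) (at y)"
    proof -
      have "((\<lambda>y. \<i> * of_real (u \<bullet> (y - x))) has_derivative (\<lambda>h. \<i> * of_real (u \<bullet> h))) (at y)"
        by (auto intro!: derivative_eq_intros)
      moreover have "(exp has_derivative (*) (exp z)) (at z)" for z :: complex
        using DERIV_exp[of z] by (simp add: has_field_derivative_def)
      ultimately show ?thesis
        unfolding cis_conv_exp using has_derivative_compose by (fastforce simp: mult.commute)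
    qed
    show ?thesis
      unfolding osc_kernel_def[abs_def] D_def
      by (rule scaleC.FDERIV[OF has_derivative_mult[OF 2
            has_derivative_compose[OF 1 schwartz_has_derivative[OF \<psi>]]] schwartz_has_derivative[OF \<phi>]])
  qed
  obtain C0 where C0: "C0 \<ge> 0" "\<And>z. norm (\<psi> z) \<le> C0"
    using schwartz_bounded[OF \<psi>] by blast
  obtain C1 where C1: "C1 \<ge> 0" "\<And>z. norm (\<psi>' z) \<le> C1"
    using schwartz_bounded[OF \<psi>'] by blast
  obtain B0 where B0: "\<And>y. norm (\<phi> y) \<le> B0 / (1 + (norm y)\<^sup>2) ^ DIM('b)"
    using schwartz_decay[OF \<phi>] by blast
  obtain B1 where B1: "\<And>y. norm (\<phi>' y) \<le> B1 / (1 + (norm y)\<^sup>2) ^ DIM('b)"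
    using schwartz_decay[OF \<phi>'] by blast
  have int0: "(LINT y|lborel. D y b) = 0"
  proof (rule integral_directional_derivative_eq_0[OF der])
    show "norm b \<le> 1"
      using b by simp
    show "norm (osc_kernel x \<psi> \<phi> \<epsilon> u y) \<le> (C0 * B0) / (1 + (norm y)\<^sup>2) ^ DIM('b)" for y
      using order_trans[OF osc_kernel_bound[of \<psi>, OF C0(2)] mult_left_mono[OF B0 C0(1)]] by simp
    show "norm (D y b) \<le> (C0 * B1 + (\<bar>\<epsilon>\<bar> * C1 + \<bar>u \<bullet> b\<bar> * C0) * B0) / (1 + (norm y)\<^sup>2) ^ DIM('b)" for y
    proof -
      have "norm (D y b) \<le> norm (osc_kernel x \<psi> \<phi>' \<epsilon> u y) + (norm (\<epsilon> *\<^sub>R osc_kernel x \<psi>' \<phi> \<epsilon> u y) +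
          norm ((\<i> * of_real (u \<bullet> b)) *\<^sub>C osc_kernel x \<psi> \<phi> \<epsilon> u y))"
        unfolding D_b by (intro norm_triangle_mono order_refl)
      also have "\<dots> \<le> C0 * norm (\<phi>' y) + (\<bar>\<epsilon>\<bar> * (C1 * norm (\<phi> y)) + \<bar>u \<bullet> b\<bar> * (C0 * norm (\<phi> y)))"
        using osc_kernel_bound[of \<psi>, OF C0(2)] osc_kernel_bound[of \<psi>', OF C1(2)]
        by (auto simp: norm_scaleC norm_mult intro!: add_mono mult_left_mono)
      also have "\<dots> = C0 * norm (\<phi>' y) + (\<bar>\<epsilon>\<bar> * C1 + \<bar>u \<bullet> b\<bar> * C0) * norm (\<phi> y)"
        by (simp add: algebra_simps)
      also have "\<dots> \<le> C0 * (B1 / (1 + (norm y)\<^sup>2) ^ DIM('b)) +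
          (\<bar>\<epsilon>\<bar> * C1 + \<bar>u \<bullet> b\<bar> * C0) * (B0 / (1 + (norm y)\<^sup>2) ^ DIM('b))"
        using B0 B1 C0(1) C1(1) by (intro add_mono mult_left_mono) auto
      finally show ?thesis
        by (simp add: add_divide_distrib)
    qed
  qed
  have int: "integrable lborel (\<lambda>y. c *\<^sub>C osc_kernel x \<psi> \<phi> \<epsilon> u y)" for c
    by (intro integrable_bounded_linear[OF scaleC.bounded_linear_right] integrable_osc_kernel \<psi> \<phi>)
  have "(LINT y|lborel. D y b) = (LINT y|lborel. osc_kernel x \<psi> \<phi>' \<epsilon> u y) +
      (\<epsilon> *\<^sub>R (LINT y|lborel. osc_kernel x \<psi>' \<phi> \<epsilon> u y) +
       (\<i> * of_real (u \<bullet> b)) *\<^sub>C (LINT y|lborel. osc_kernel x \<psi> \<phi> \<epsilon> u y))"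
    unfolding D_b using int integrable_osc_kernel[OF \<psi>' \<phi>, of x \<epsilon> u] integrable_osc_kernel[OF \<psi> \<phi>', of x \<epsilon> u]
    by (simp add: integral_scaleC_right)
  with int0 show ?thesis
    by (simp only: eq_neg_iff_add_eq_0 add_ac)
qed

text \<open>Each factor 1 + |u . b| costs one integration by parts, which differentiates \<psi> or
  \<phi>; the induction therefore generalises over both. Restricting to \<epsilon> \<le> 1 absorbs
  the factor \<epsilon> and makes the constant uniform.\<close>

lemma osc_kernel_weighted_bound:
  fixes \<phi> :: "'b::euclidean_space \<Rightarrow> 'a::separable_cstar_algebra"
  assumes "\<psi> \<in> schwartz" "\<phi> \<in> schwartz" "set bs \<subseteq> Basis"
  shows "\<exists>C. \<forall>\<epsilon>\<in>{0<..1}. \<forall>u.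
    (\<Prod>b\<leftarrow>bs. 1 + \<bar>u \<bullet> b\<bar>) * norm (LINT y|lborel. osc_kernel x \<psi> \<phi> \<epsilon> u y) \<le> C"
  using assms
proof (induction bs arbitrary: \<psi> \<phi>)
  case Nil
  obtain C where C: "C \<ge> 0" "\<And>z. norm (\<psi> z) \<le> C"
    using schwartz_bounded[OF Nil(1)] by blast
  have bound: "norm (LINT y|lborel. osc_kernel x \<psi> \<phi> \<epsilon> u y) \<le> (LINT y|lborel. C * norm (\<phi> y))" for \<epsilon> u
  proof -
    have "norm (LINT y|lborel. osc_kernel x \<psi> \<phi> \<epsilon> u y) \<le> (LINT y|lborel. norm (osc_kernel x \<psi> \<phi> \<epsilon> u y))"
      by (rule integral_norm_bound)
    also have "\<dots> \<le> (LINT y|lborel. C * norm (\<phi> y))"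
      by (intro integral_mono integrable_norm integrable_osc_kernel Nil(1,2)
          integrable_mult_right integrable_schwartz osc_kernel_bound C)
    finally show ?thesis .
  qed
  show ?case
    by (rule exI[of _ "LINT y|lborel. C * norm (\<phi> y)"]) (use bound in simp)
next
  case (Cons b bs)
  have b: "b \<in> Basis" and bs: "set bs \<subseteq> Basis"
    using Cons.prems(3) by auto
  then have b': "(0, b) \<in> (Basis :: ('b \<times> 'b) set)"
    by (simp add: Basis_prod_def)
  define \<psi>' where "\<psi>' = (\<lambda>z. frechet_derivative \<psi> (at z) (0, b))"
  define \<phi>' where "\<phi>' = (\<lambda>y. frechet_derivative \<phi> (at y) b)"
  have \<psi>': "\<psi>' \<in> schwartz" and \<phi>': "\<phi>' \<in> schwartz"
    unfolding \<psi>'_def \<phi>'_def by (intro schwartz_partial Cons.prems b b')+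
  define P where "P = (\<lambda>u. \<Prod>b\<leftarrow>bs. 1 + \<bar>u \<bullet> b\<bar>)"
  define I where "I = (\<lambda>\<psi> \<phi> \<epsilon> u. LINT y|lborel. osc_kernel x \<psi> (\<phi> :: 'b \<Rightarrow> 'a) \<epsilon> u y)"
  have P: "P u \<ge> 0" for u
    unfolding P_def by (intro prod_list_nonneg) auto
  obtain C0 where C0: "\<And>\<epsilon> u. \<epsilon> \<in> {0<..1} \<Longrightarrow> P u * norm (I \<psi> \<phi> \<epsilon> u) \<le> C0"
    using Cons.IH[OF Cons.prems(1,2) bs] unfolding P_def I_def by blast
  obtain C1 where C1: "\<And>\<epsilon> u. \<epsilon> \<in> {0<..1} \<Longrightarrow> P u * norm (I \<psi>' \<phi> \<epsilon> u) \<le> C1"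
    using Cons.IH[OF \<psi>' Cons.prems(2) bs] unfolding P_def I_def by blast
  obtain C2 where C2: "\<And>\<epsilon> u. \<epsilon> \<in> {0<..1} \<Longrightarrow> P u * norm (I \<psi> \<phi>' \<epsilon> u) \<le> C2"
    using Cons.IH[OF Cons.prems(1) \<phi>' bs] unfolding P_def I_def by blast
  have "(1 + \<bar>u \<bullet> b\<bar>) * P u * norm (I \<psi> \<phi> \<epsilon> u) \<le> C0 + (C1 + C2)" if \<epsilon>: "\<epsilon> \<in> {0<..1}" for \<epsilon> u
  proof -
    have "\<bar>u \<bullet> b\<bar> * norm (I \<psi> \<phi> \<epsilon> u) = norm ((\<i> * of_real (u \<bullet> b)) *\<^sub>C I \<psi> \<phi> \<epsilon> u)"
      by (simp add: norm_scaleC norm_mult)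
    also have "\<dots> = norm (\<epsilon> *\<^sub>R I \<psi>' \<phi> \<epsilon> u + I \<psi> \<phi>' \<epsilon> u)"
      using osc_kernel_by_parts[OF Cons.prems(1,2) b]
      unfolding I_def \<psi>'_def \<phi>'_def by (simp only: norm_minus_cancel)
    also have "\<dots> \<le> norm (I \<psi>' \<phi> \<epsilon> u) + norm (I \<psi> \<phi>' \<epsilon> u)"
      using \<epsilon> by (intro norm_triangle_mono) (auto intro!: mult_left_le_one_le)
    finally have "P u * (\<bar>u \<bullet> b\<bar> * norm (I \<psi> \<phi> \<epsilon> u)) \<le> P u * (norm (I \<psi>' \<phi> \<epsilon> u) + norm (I \<psi> \<phi>' \<epsilon> u))"
      using P by (rule mult_left_mono)
    then show ?thesis
      using C0[OF \<epsilon>, of u] C1[OF \<epsilon>, of u] C2[OF \<epsilon>, of u] by (simp add: algebra_simps)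
  qed
  then show ?case
    unfolding P_def I_def by (intro exI[of _ "C0 + (C1 + C2)"]) simp
qed

text \<open>Every basis vector is listed twice: one factor 1 + |t| per coordinate would not be
  integrable after inversion, whereas (1 + |t|)^2 dominates 1 + t^2. The result is the majorant for
  the u-integral as \<epsilon> tends to 0.\<close>

lemma osc_kernel_decay:
  fixes \<phi> :: "'b::euclidean_space \<Rightarrow> 'a::separable_cstar_algebra"
  assumes "\<psi> \<in> schwartz" "\<phi> \<in> schwartz"
  obtains C where "\<And>\<epsilon> u. \<epsilon> \<in> {0<..1} \<Longrightarrow>
    norm (LINT y|lborel. osc_kernel x \<psi> \<phi> \<epsilon> u y) \<le> C * decay_weight u"
proof -
  obtain bs :: "'b list" where bs: "set bs = Basis" "distinct bs"
    using finite_distinct_list[OF finite_Basis] by blast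
  have "set (bs @ bs) \<subseteq> Basis"
    using bs by simp
  from osc_kernel_weighted_bound[OF assms this, of x]
  obtain C where C: "\<And>\<epsilon> u. \<epsilon> \<in> {0<..1} \<Longrightarrow>
    (\<Prod>b\<leftarrow>bs @ bs. 1 + \<bar>u \<bullet> b\<bar>) * norm (LINT y|lborel. osc_kernel x \<psi> \<phi> \<epsilon> u y) \<le> C"
    by blast
  have "norm (LINT y|lborel. osc_kernel x \<psi> \<phi> \<epsilon> u y) \<le> C * decay_weight u" if \<epsilon>: "\<epsilon> \<in> {0<..1}" for \<epsilon> u
  proof -
    define N where "N = norm (LINT y|lborel. osc_kernel x \<psi> \<phi> \<epsilon> u y)"
    have "inverse (decay_weight u) = (\<Prod>b\<in>Basis. 1 + (u \<bullet> b)\<^sup>2)"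
      by (simp add: decay_weight_def prod_inversef[symmetric] comp_def)
    also have "\<dots> \<le> (\<Prod>b\<in>Basis. (1 + \<bar>u \<bullet> b\<bar>) * (1 + \<bar>u \<bullet> b\<bar>))"
      by (intro prod_mono) (auto simp: power2_eq_square algebra_simps)
    also have "\<dots> = (\<Prod>b\<leftarrow>bs @ bs. 1 + \<bar>u \<bullet> b\<bar>)"
      using bs by (simp add: prod.distrib flip: prod.distinct_set_conv_list)
    finally have "inverse (decay_weight u) * N \<le> (\<Prod>b\<leftarrow>bs @ bs. 1 + \<bar>u \<bullet> b\<bar>) * N"
      by (rule mult_right_mono) (simp add: N_def)
    also have "\<dots> \<le> C"
      using C[OF \<epsilon>] by (simp add: N_def)
    finally show ?thesis
      using decay_weight_pos[of u] by (simp add: N_def field_simps)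
  qed
  then show ?thesis
    using that by blast
qed

text \<open>The substitution \<epsilon> = 1 / t turns the limit into one at infinity, and the range
  \<epsilon> \<le> 1 of the bound into t \<ge> 1.\<close>

lemma integral_dominated_convergence_at_right_0:
  fixes s :: "real \<Rightarrow> 'c \<Rightarrow> 'a::{banach, second_countable_topology}"
  assumes "f \<in> borel_measurable M" "\<And>\<epsilon>. s \<epsilon> \<in> borel_measurable M" "integrable M w"
    and lim: "\<And>x. ((\<lambda>\<epsilon>. s \<epsilon> x) \<longlongrightarrow> f x) (at_right 0)"
    and bound: "\<And>\<epsilon> x. \<epsilon> \<in> {0<..1} \<Longrightarrow> norm (s \<epsilon> x) \<le> w x"
  shows "((\<lambda>\<epsilon>. integral\<^sup>L M (s \<epsilon>)) \<longlongrightarrow> integral\<^sup>L M f) (at_right 0)"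
proof -
  have "((\<lambda>t. integral\<^sup>L M (s (inverse t))) \<longlongrightarrow> integral\<^sup>L M f) at_top"
  proof (rule integral_dominated_convergence_at_top[OF assms(1,2,3)])
    show "AE x in M. ((\<lambda>t. s (inverse t) x) \<longlongrightarrow> f x) at_top"
      using lim by (simp add: filterlim_at_right_to_top)
    have "norm (s (inverse t) x) \<le> w x" if "t \<ge> 1" for t x
      using that by (intro bound) (auto simp: inverse_le_1_iff)
    then show "\<forall>\<^sub>F t in at_top. AE x in M. norm (s (inverse t) x) \<le> w x"
      by (auto simp: eventually_at_top_linorder)
  qed
  then show ?thesis
    by (simp add: filterlim_at_right_to_top)
qed

lemma measurable_parametric_integral:
  fixes k :: "'b::euclidean_space \<Rightarrow> 'c::euclidean_space \<Rightarrow> 'a::{banach, second_countable_topology}"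
  assumes "continuous_on UNIV (\<lambda>(u, y). k u y)"
  shows "(\<lambda>u. LINT y|lborel. k u y) \<in> borel_measurable borel"
proof -
  have "case_prod k \<in> borel_measurable (lborel \<Otimes>\<^sub>M lborel)"
    unfolding lborel_prod using borel_measurable_continuous_onI[OF assms] by simp
  from lborel.borel_measurable_lebesgue_integral[OF this] show ?thesis
    by simp
qed

lemma osc_kernel_tendsto:
  fixes \<phi> :: "'b::euclidean_space \<Rightarrow> 'a::separable_cstar_algebra"
  assumes \<psi>: "\<psi> \<in> schwartz" and "\<psi> 0 = 1" and \<phi>: "\<phi> \<in> schwartz"
  shows "((\<lambda>\<epsilon>. LINT y|lborel. osc_kernel x \<psi> \<phi> \<epsilon> u y) \<longlongrightarrow>
    (LINT y|lborel. cis (u \<bullet> (y - x)) *\<^sub>C \<phi> y)) (at_right 0)"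
proof -
  obtain C where C: "C \<ge> 0" "\<And>z. norm (\<psi> z) \<le> C"
    using schwartz_bounded[OF \<psi>] by blast
  show ?thesis
  proof (rule integral_dominated_convergence_at_right_0)
    show "(\<lambda>y. cis (u \<bullet> (y - x)) *\<^sub>C \<phi> y) \<in> borel_measurable lborel"
      unfolding measurable_lborel2
      by (intro borel_measurable_continuous_onI continuous_intros schwartz_continuous \<phi>)
    show "osc_kernel x \<psi> \<phi> \<epsilon> u \<in> borel_measurable lborel" for \<epsilon>
      using borel_measurable_integrable[OF integrable_osc_kernel[OF \<psi> \<phi>]] .
    show "integrable lborel (\<lambda>y. C * norm (\<phi> y))"
      using integrable_schwartz[OF \<phi>] by simp
    show "norm (osc_kernel x \<psi> \<phi> \<epsilon> u y) \<le> C * norm (\<phi> y)" for \<epsilon> y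
      by (rule osc_kernel_bound[OF C(2)])
    fix y
    have "isCont (\<lambda>\<epsilon>. osc_kernel x \<psi> \<phi> \<epsilon> u y) 0"
    proof -
      have "continuous_on UNIV (\<lambda>\<epsilon>. osc_kernel x \<psi> \<phi> \<epsilon> u y)"
        unfolding osc_kernel_def
        by (intro continuous_intros continuous_on_compose2[OF schwartz_continuous[OF \<psi>, of UNIV] _ subset_UNIV])
      then show ?thesis
        by (simp add: continuous_on_eq_continuous_at)
    qed
    then have "((\<lambda>\<epsilon>. osc_kernel x \<psi> \<phi> \<epsilon> u y) \<longlongrightarrow> osc_kernel x \<psi> \<phi> 0 u y) (at 0)"
      by (rule isContD)
    moreover have "osc_kernel x \<psi> \<phi> 0 u y = cis (u \<bullet> (y - x)) *\<^sub>C \<phi> y"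
      using \<open>\<psi> 0 = 1\<close> by (simp add: osc_kernel_def zero_prod_def)
    ultimately show "((\<lambda>\<epsilon>. osc_kernel x \<psi> \<phi> \<epsilon> u y) \<longlongrightarrow> cis (u \<bullet> (y - x)) *\<^sub>C \<phi> y) (at_right 0)"
      using tendsto_within_subset by fastforce
  qed
qed

text \<open>G is merely bounded, so the double integral need not converge absolutely. Carrying out
  the inner integral before removing the cut-off restores convergence: the u-integrand is then
  dominated by a multiple of \<open>decay_weight\<close>, uniformly in \<epsilon>.\<close>

lemma has_osc_integral_mult_translate:
  fixes G \<phi> :: "'b::euclidean_space \<Rightarrow> 'a::separable_cstar_algebra"
  assumes G: "continuous_on UNIV G" and B: "\<And>u. norm (G u) \<le> B" and \<phi>: "\<phi> \<in> schwartz"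
  shows "has_osc_integral (\<lambda>(u, v). cis (u \<bullet> v) *\<^sub>C (G u * \<phi> (x + v)))
    (LINT u|lborel. G u * (LINT y|lborel. cis (u \<bullet> (y - x)) *\<^sub>C \<phi> y))"
  unfolding has_osc_integral_def
proof (intro allI impI)
  fix \<psi> :: "'b \<times> 'b \<Rightarrow> complex"
  assume \<psi>: "\<psi> \<in> schwartz" "\<psi> 0 = 1"
  define I where "I = (\<lambda>\<epsilon> u. LINT y|lborel. osc_kernel x \<psi> \<phi> \<epsilon> u y)"
  have B0: "B \<ge> 0"
    using order_trans[OF norm_ge_zero B] .
  have cont_\<phi>: "continuous_on UNIV (\<lambda>z. \<phi> (f z))" if "continuous_on UNIV f" for f :: "'b \<times> 'b \<Rightarrow> 'b"
    using continuous_on_compose2[OF schwartz_continuous[OF \<phi>, of UNIV] that] by simp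
  have cont_G: "continuous_on UNIV (\<lambda>z. G (f z))" if "continuous_on UNIV f" for f :: "'b \<times> 'b \<Rightarrow> 'b"
    using continuous_on_compose2[OF G that] by simp
  have cont_\<psi>: "continuous_on UNIV (\<lambda>z. \<psi> (f z))" if "continuous_on UNIV f" for f :: "'b \<times> 'b \<Rightarrow> 'b \<times> 'b"
    using continuous_on_compose2[OF schwartz_continuous[OF \<psi>(1), of UNIV] that] by simp
  \<comment> \<open>For \<epsilon> > 0 the dilated cut-off is integrable on the product space and
    the other factors are bounded, which justifies Fubini; translating v by x then produces
    \<open>osc_kernel\<close>.\<close>
  have "(LINT z|lborel. \<psi> (\<epsilon> *\<^sub>R z) *\<^sub>C (case z of (u, v) \<Rightarrow> cis (u \<bullet> v) *\<^sub>C (G u * \<phi> (x + v)))) =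
      (LINT u|lborel. G u * I \<epsilon> u)" if "\<epsilon> > 0" for \<epsilon>
  proof -
    define k where "k = (\<lambda>z. \<psi> (\<epsilon> *\<^sub>R z) *\<^sub>C (cis (fst z \<bullet> snd z) *\<^sub>C (G (fst z) * \<phi> (x + snd z))))"
    obtain C where C: "C \<ge> 0" "\<And>y. norm (\<phi> y) \<le> C"
      using schwartz_bounded[OF \<phi>] by blast
    have int: "integrable (lborel \<Otimes>\<^sub>M lborel) k"
      unfolding lborel_prod
    proof (rule Bochner_Integration.integrable_bound)
      show "integrable lborel (\<lambda>z. norm (\<psi> (\<epsilon> *\<^sub>R z)) * (B * C))"
        using integrable_lborel_affine[of \<epsilon> \<psi> 0] integrable_schwartz[OF \<psi>(1)] \<open>\<epsilon> > 0\<close> by simp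
      have "continuous_on UNIV k"
        unfolding k_def by (intro continuous_intros cont_\<phi> cont_G cont_\<psi>)
      then show "k \<in> borel_measurable lborel"
        using borel_measurable_continuous_onI by auto
      have "norm (k z) \<le> norm (\<psi> (\<epsilon> *\<^sub>R z)) * (B * C)" for z
      proof -
        have "norm (G (fst z) * \<phi> (x + snd z)) \<le> B * C"
          using B0 by (intro norm_mult_ineq[THEN order_trans] mult_mono B C norm_ge_zero)
        then show ?thesis
          by (simp add: k_def norm_scaleC mult_left_mono)
      qed
      then show "AE z in lborel. norm (k z) \<le> norm (norm (\<psi> (\<epsilon> *\<^sub>R z)) * (B * C))"
        using B0 C(1) by (intro AE_I2) simp
    qed
    have k_eq: "k (u, v) = G u * osc_kernel x \<psi> \<phi> \<epsilon> u (x + v)" for u v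
      by (simp add: k_def osc_kernel_def scaleC_scaleC mult_scaleC_right mult.commute)
    have "(LINT z|lborel. \<psi> (\<epsilon> *\<^sub>R z) *\<^sub>C (case z of (u, v) \<Rightarrow> cis (u \<bullet> v) *\<^sub>C (G u * \<phi> (x + v)))) =
        integral\<^sup>L (lborel \<Otimes>\<^sub>M lborel) k"
      by (simp add: lborel_prod k_def split_beta)
    also have "\<dots> = (LINT u|lborel. LINT v|lborel. k (u, v))"
      using lborel_pair.integral_fst'[OF int] by simp
    also have "\<dots> = (LINT u|lborel. G u * I \<epsilon> u)"
    proof (rule Bochner_Integration.integral_cong)
      fix u
      have int': "integrable lborel (\<lambda>v. osc_kernel x \<psi> \<phi> \<epsilon> u (x + v))"
        using integrable_lborel_affine[where c = 1 and t = x, OF _ integrable_osc_kernel[OF \<psi>(1) \<phi>, of x \<epsilon> u]] by simp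
      have "(LINT v|lborel. k (u, v)) = G u * (LINT v|lborel. osc_kernel x \<psi> \<phi> \<epsilon> u (x + v))"
        unfolding k_eq using int' by simp
      also have "(LINT v|lborel. osc_kernel x \<psi> \<phi> \<epsilon> u (x + v)) = I \<epsilon> u"
        unfolding I_def
        by (intro integral_lborel_translate borel_measurable_continuous_onI continuous_osc_kernel(1) \<psi> \<phi>)
      finally show "(LINT v|lborel. k (u, v)) = G u * I \<epsilon> u" .
    qed simp
    finally show ?thesis .
  qed
  then have ev: "\<forall>\<^sub>F \<epsilon> in at_right 0. (LINT u|lborel. G u * I \<epsilon> u) =
      (LINT z|lborel. \<psi> (\<epsilon> *\<^sub>R z) *\<^sub>C (case z of (u, v) \<Rightarrow> cis (u \<bullet> v) *\<^sub>C (G u * \<phi> (x + v))))"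
    by (auto simp: eventually_at_right_field intro!: exI[of _ 1])
  obtain C where C: "\<And>\<epsilon> u. \<epsilon> \<in> {0<..1} \<Longrightarrow> norm (I \<epsilon> u) \<le> C * decay_weight u"
    unfolding I_def using osc_kernel_decay[OF \<psi>(1) \<phi>] by blast
  have [measurable]: "G \<in> borel_measurable lborel"
    using borel_measurable_continuous_onI[OF G] by simp
  have "((\<lambda>\<epsilon>. LINT u|lborel. G u * I \<epsilon> u) \<longlongrightarrow>
      (LINT u|lborel. G u * (LINT y|lborel. cis (u \<bullet> (y - x)) *\<^sub>C \<phi> y))) (at_right 0)"
  proof (rule integral_dominated_convergence_at_right_0)
    have [measurable]: "I \<epsilon> \<in> borel_measurable borel" for \<epsilon>
      unfolding I_def by (rule measurable_parametric_integral[OF continuous_osc_kernel(2)[OF \<psi>(1) \<phi>]])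
    show "(\<lambda>u. G u * I \<epsilon> u) \<in> borel_measurable lborel" for \<epsilon>
      by measurable
    have [measurable]: "(\<lambda>u. LINT y|lborel. cis (u \<bullet> (y - x)) *\<^sub>C \<phi> y) \<in> borel_measurable borel"
      by (rule measurable_parametric_integral, unfold split_beta) (intro continuous_intros cont_\<phi>)
    show "(\<lambda>u. G u * (LINT y|lborel. cis (u \<bullet> (y - x)) *\<^sub>C \<phi> y)) \<in> borel_measurable lborel"
      by measurable
    show "integrable lborel (\<lambda>u::'b. B * (C * decay_weight u))"
      by (intro integrable_mult_right integrable_decay_weight)
    show "norm (G u * I \<epsilon> u) \<le> B * (C * decay_weight u)" if "\<epsilon> \<in> {0<..1}" for \<epsilon> u
      using B0 C[OF that] by (intro norm_mult_ineq[THEN order_trans] mult_mono B norm_ge_zero)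
    show "((\<lambda>\<epsilon>. G u * I \<epsilon> u) \<longlongrightarrow> G u * (LINT y|lborel. cis (u \<bullet> (y - x)) *\<^sub>C \<phi> y)) (at_right 0)" for u
      unfolding I_def by (intro tendsto_intros osc_kernel_tendsto \<psi> \<phi>)
  qed
  then show "((\<lambda>\<epsilon>. LINT z|lborel. \<psi> (\<epsilon> *\<^sub>R z) *\<^sub>C (case z of (u, v) \<Rightarrow> cis (u \<bullet> v) *\<^sub>C (G u * \<phi> (x + v)))) \<longlongrightarrow>
      (LINT u|lborel. G u * (LINT y|lborel. cis (u \<bullet> (y - x)) *\<^sub>C \<phi> y))) (at_right 0)"
    by (rule Lim_transform_eventually[OF _ ev])
qed

text \<open>Uniqueness needs an actual cut-off with value 1 at 0, since the defining condition only
  quantifies over them; the unit Gaussian is one.\<close>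

lemma osc_integral_eqI:
  assumes "has_osc_integral h l"
  shows "osc_integral h = l"
  unfolding osc_integral_def
proof (rule the_equality[of "has_osc_integral h", OF assms])
  fix l' assume l': "has_osc_integral h l'"
  have "gaussian 1 0 0 \<in> schwartz" "gaussian 1 0 0 0 = 1"
    by (simp_all add: schwartz_gaussian gaussian_def)
  with assms l' show "l' = l"
    unfolding has_osc_integral_def by (metis (no_types, lifting) tendsto_unique trivial_limit_at_right_real)
qed

text \<open>The inner integral is an unnormalised Fourier integral at -u times a phase, and u =
  -\<xi> turns F(x + Ju) into F(x - J\<xi>). The factor (2 pi)^(-n) splits into two equal parts, one
  for \<open>fourier\<close> and one for \<open>pseudo_diff\<close>.\<close>

lemma deformed_product_eq_pseudo_diff:
  fixes F \<phi> :: "real^'n \<Rightarrow> 'a::separable_cstar_algebra"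
  assumes F: "continuous_on UNIV F" and B: "\<And>x. norm (F x) \<le> B" and \<phi>: "\<phi> \<in> schwartz"
  shows "deformed_product J F \<phi> x = pseudo_diff (\<lambda>(x, \<xi>). F (x - J *v \<xi>)) \<phi> x"
proof -
  define c :: real where "c = (2 * pi) powr (- real CARD('n) / 2)"
  define M where "M = (\<lambda>\<xi>. LINT y|lborel. cis (- (\<xi> \<bullet> y)) *\<^sub>C \<phi> y)"
  define K where "K = (\<lambda>u. LINT y|lborel. cis (u \<bullet> (y - x)) *\<^sub>C \<phi> y)"
  have cc: "c * c = (2 * pi) powr (- real CARD('n))"
    unfolding c_def by (simp flip: powr_add)
  have cont: "continuous_on UNIV (\<lambda>u. F (x + J *v u))"
    by (intro continuous_on_compose2[OF F] continuous_intros) auto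
  have K: "K (- \<xi>) = cis (x \<bullet> \<xi>) *\<^sub>C M \<xi>" for \<xi>
  proof -
    have "cis (- \<xi> \<bullet> (y - x)) *\<^sub>C \<phi> y = cis (x \<bullet> \<xi>) *\<^sub>C cis (- (\<xi> \<bullet> y)) *\<^sub>C \<phi> y" for y
      by (simp add: scaleC_scaleC cis_mult inner_diff_right inner_commute[of x])
    then show ?thesis
      by (simp add: K_def M_def integral_scaleC_right)
  qed
  have "osc_integral (\<lambda>(u, v). cis (u \<bullet> v) *\<^sub>C (F (x + J *v u) * \<phi> (x + v))) =
      (LINT u|lborel. F (x + J *v u) * K u)"
    unfolding K_def by (intro osc_integral_eqI has_osc_integral_mult_translate[OF cont B \<phi>])
  also have "\<dots> = (LINT \<xi>|lborel. F (x + J *v (- \<xi>)) * K (- \<xi>))"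
  proof (rule integral_lborel_reflect[symmetric])
    have "K \<in> borel_measurable borel"
      unfolding K_def
      by (rule measurable_parametric_integral, unfold split_beta)
        (intro continuous_intros continuous_on_compose2[OF schwartz_continuous[OF \<phi>, of UNIV] _ subset_UNIV])
    then show "(\<lambda>u. F (x + J *v u) * K u) \<in> borel_measurable borel"
      using borel_measurable_continuous_onI[OF cont] by measurable
  qed
  also have "\<dots> = (LINT \<xi>|lborel. cis (x \<bullet> \<xi>) *\<^sub>C (F (x - J *v \<xi>) * M \<xi>))"
    by (simp add: K mult_scaleC_right linear_neg[OF matrix_vector_mul_linear])
  finally have "deformed_product J F \<phi> x =
      (c * c) *\<^sub>R (LINT \<xi>|lborel. cis (x \<bullet> \<xi>) *\<^sub>C (F (x - J *v \<xi>) * M \<xi>))"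
    by (simp add: deformed_product_def cc)
  also have "\<dots> = c *\<^sub>R (LINT \<xi>|lborel. cis (x \<bullet> \<xi>) *\<^sub>C (F (x - J *v \<xi>) * (c *\<^sub>R M \<xi>)))"
    by (simp add: scaleC_scaleR_right)
  also have "\<dots> = pseudo_diff (\<lambda>(x, \<xi>). F (x - J *v \<xi>)) \<phi> x"
    by (simp add: pseudo_diff_def fourier_def M_def c_def)
  finally show ?thesis .
qed

section \<open>Fourier transforms of Gaussians\<close>

text \<open>By translation invariance the inner integral of |g(y - L p)| does not depend on p.
  Below, L is J in one case and the identity in the other.\<close>

lemma integrable_shear:
  fixes f :: "'b::euclidean_space \<Rightarrow> real" and g :: "'c::euclidean_space \<Rightarrow> real"
  assumes f: "integrable lborel f" "continuous_on UNIV f"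
    and g: "integrable lborel g" "continuous_on UNIV g"
    and L: "continuous_on UNIV L"
  shows "integrable lborel (\<lambda>(p, y). f p * g (y - L p))"
  unfolding lborel_prod[symmetric]
proof (rule lborel_pair.Fubini_integrable)
  have "continuous_on UNIV (\<lambda>(p, y). f p * g (y - L p))"
    unfolding split_beta
    by (intro continuous_intros continuous_on_compose2[OF f(2)] continuous_on_compose2[OF g(2)]
        continuous_on_compose2[OF L] subset_UNIV)
  then show "(\<lambda>(p, y). f p * g (y - L p)) \<in> borel_measurable (lborel \<Otimes>\<^sub>M lborel)"
    unfolding lborel_prod measurable_lborel2 by (rule borel_measurable_continuous_onI)
  have int: "integrable lborel (\<lambda>y. g (y - L p))" for p
    using integrable_lborel_affine[where c = 1 and t = "- L p", OF _ g(1)] by simp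
  then show "AE p in lborel. integrable lborel (\<lambda>y. case (p, y) of (p, y) \<Rightarrow> f p * g (y - L p))"
    by (intro AE_I2) simp
  have "(LINT y|lborel. \<bar>g (y - L p)\<bar>) = (LINT y|lborel. \<bar>g y\<bar>)" for p
    using integral_lborel_translate[of "\<lambda>y. \<bar>g y\<bar>" "- L p"] borel_measurable_integrable[OF g(1)] by simp
  then show "integrable lborel (\<lambda>p. LINT y|lborel. norm (case (p, y) of (p, y) \<Rightarrow> f p * g (y - L p)))"
    using f(1) by (simp add: abs_mult)
qed

text \<open>\<open>gauss s\<close> is, up to a factor, the Fourier transform of \<open>gaussian s 0 0\<close>.\<close>

definition gauss :: "real \<Rightarrow> 'b::euclidean_space \<Rightarrow> real" where
  "gauss s x = exp (- (norm x)\<^sup>2 / (2 * s\<^sup>2))"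

lemma gauss_inverse: "gauss (inverse s) x = exp (- s\<^sup>2 * (norm x)\<^sup>2 / 2)"
proof -
  \<comment> \<open>At s = 0 the conventions for inversion and division make both exponents
    0.\<close>
  have "- r / (2 * (inverse s)\<^sup>2) = - s\<^sup>2 * r / 2" for r
    by (cases "s = 0") (simp_all add: field_simps)
  then show ?thesis
    by (simp only: gauss_def)
qed

lemma gaussian_eq_gauss: "gaussian s q x0 x = cis (q \<bullet> x) * of_real (gauss (inverse s) (x - x0))"
  by (simp only: gaussian_def gauss_inverse)

lemma gauss_nonneg: "gauss s x \<ge> 0"
  by (simp add: gauss_def)

lemma gauss_minus_commute: "gauss s (x - y) = gauss s (y - x)"
  by (simp add: gauss_def norm_minus_commute)

lemma continuous_gauss [continuous_intros]:
  "continuous_on S f \<Longrightarrow> continuous_on S (\<lambda>x. gauss s (f x))"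
  unfolding gauss_def divide_inverse by (intro continuous_intros)

lemma integrable_gauss:
  assumes "s > 0"
  shows "integrable lborel (\<lambda>x. gauss s (x - q))"
proof -
  have "integrable lborel (\<lambda>x. norm (gaussian (inverse s) 0 q x))"
    using assms by (intro integrable_norm integrable_schwartz schwartz_gaussian) simp
  then show ?thesis
    using assms by (simp add: gaussian_eq_gauss norm_mult gauss_nonneg)
qed

lemma integral_cis_gauss:
  fixes \<eta> :: "'b::euclidean_space"
  assumes s: "s > 0"
  shows "(LINT x|lborel. cis (\<eta> \<bullet> x) * of_real (gauss (inverse s) x)) =
    of_real ((sqrt (2 * pi) / s) ^ DIM('b) * gauss s \<eta>)"
  unfolding gauss_inverse unfolding gauss_def by (rule integral_cis_gaussian[OF s])

lemma fourier_gaussian: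
  fixes d :: "'a::separable_cstar_algebra" and \<xi> :: "real^'n"
  assumes s: "s > 0"
  shows "fourier (\<lambda>x. gaussian s q 0 x *\<^sub>C d) \<xi> =
    ((2 * pi) powr (- real CARD('n) / 2) * (sqrt (2 * pi) / s) ^ CARD('n) * gauss s (\<xi> - q)) *\<^sub>R d"
proof -
  define E where "E = (\<lambda>y. cis ((q - \<xi>) \<bullet> y) * of_real (gauss (inverse s) y))"
  have E: "cis (- (\<xi> \<bullet> y)) *\<^sub>C gaussian s q 0 y *\<^sub>C d = E y *\<^sub>C d" for y
    using s by (simp add: E_def gaussian_eq_gauss scaleC_scaleC cis_mult inner_diff_left flip: mult.assoc)
  have "E = gaussian s (q - \<xi>) 0"
    using s by (simp add: E_def gaussian_eq_gauss fun_eq_iff)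
  then have "integrable lborel E"
    using integrable_schwartz[OF schwartz_gaussian[OF s]] by simp
  then have "(LINT y|lborel. E y *\<^sub>C d) = (LINT y|lborel. E y) *\<^sub>C d"
    by (rule integral_scaleC_left)
  also have "(LINT y|lborel. E y) = of_real ((sqrt (2 * pi) / s) ^ CARD('n) * gauss s (\<xi> - q))"
    unfolding E_def integral_cis_gauss[OF s] by (simp add: gauss_minus_commute)
  finally have "(LINT y|lborel. E y *\<^sub>C d) = ((sqrt (2 * pi) / s) ^ CARD('n) * gauss s (\<xi> - q)) *\<^sub>R d"
    by (simp only: scaleR_scaleC)
  then show ?thesis
    unfolding fourier_def E by (simp add: mult.assoc)
qed

section \<open>Bounded smooth symbols\<close>

lemma CB_inf_differentiable: "f \<in> CB_inf \<Longrightarrow> f differentiable (at x)"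
proof -
  assume "f \<in> CB_inf"
  then have "iter_partial [] f differentiable_on UNIV"
    unfolding CB_inf_def smooth_def by blast
  then show ?thesis
    by (simp add: differentiable_on_def)
qed

lemma CB_inf_continuous: "f \<in> CB_inf \<Longrightarrow> continuous_on S f"
  by (meson CB_inf_differentiable continuous_at_imp_continuous_on differentiable_imp_continuous_within)

lemma CB_inf_bounded:
  assumes "f \<in> CB_inf"
  obtains B where "\<And>x. norm (f x) \<le> B"
proof -
  have "bounded (range (iter_partial [] f))"
    using assms unfolding CB_inf_def by blast
  then show ?thesis
    using that by (auto simp: bounded_iff)
qed

text \<open>Partial derivatives of the restriction are partial derivatives of \<open>a\<close> along
  the basis vectors (v, 0), evaluated at (x, 0). Smoothness and bounds are thus inherited by
  induction on the list of directions.\<close>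

lemma CB_inf_restrict:
  fixes a :: "('b::euclidean_space) \<times> ('c::euclidean_space) \<Rightarrow> 'a::real_normed_vector"
  assumes a: "a \<in> CB_inf"
  shows "(\<lambda>x. a (x, 0)) \<in> CB_inf"
proof -
  have lists: "map (\<lambda>v. (v, 0)) vs \<in> lists (Basis :: ('b \<times> 'c) set)" if "vs \<in> lists Basis" for vs
    using that by (auto simp: Basis_prod_def in_lists_conv_set)
  have iter: "iter_partial vs (\<lambda>x. a (x, 0)) = (\<lambda>x. iter_partial (map (\<lambda>v. (v, 0)) vs) a (x, 0)) \<and>
      (\<forall>x. iter_partial vs (\<lambda>x. a (x, 0)) differentiable (at x))"
    if "vs \<in> lists Basis" for vs
  proof -
    have D: "((\<lambda>x. iter_partial (map (\<lambda>v. (v, 0)) ws) a (x, 0)) has_derivative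
        (\<lambda>h. frechet_derivative (iter_partial (map (\<lambda>v. (v, 0)) ws) a) (at (x, 0)) (h, 0))) (at x)"
      if "ws \<in> lists Basis" for ws :: "'b list" and x
    proof -
      have "(iter_partial (map (\<lambda>v. (v, 0)) ws) a) differentiable (at (x, 0))"
        using a lists[OF that] unfolding CB_inf_def smooth_def by (simp add: differentiable_on_def)
      then have "((iter_partial (map (\<lambda>v. (v, 0)) ws) a) has_derivative
          frechet_derivative (iter_partial (map (\<lambda>v. (v, 0)) ws) a) (at (x, 0))) (at (x, 0))"
        using frechet_derivative_works by blast
      moreover have "((\<lambda>x. (x, 0 :: 'c)) has_derivative (\<lambda>h. (h, 0))) (at x)"
        by (auto intro!: derivative_eq_intros)
      ultimately show ?thesis
        using has_derivative_compose by blast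
    qed
    have "iter_partial vs (\<lambda>x. a (x, 0)) = (\<lambda>x. iter_partial (map (\<lambda>v. (v, 0)) vs) a (x, 0))"
      using that
    proof induction
      case (Cons v vs)
      show ?case
        by (rule ext) (simp add: Cons.IH frechet_derivative_at[OF D[OF Cons.hyps(2)], symmetric])
    qed simp
    with differentiableI[OF D[OF that]] show ?thesis
      by simp
  qed
  have bd: "bounded (range (\<lambda>x. g (x, 0)))" if "bounded (range g)" for g :: "'b \<times> 'c \<Rightarrow> 'a"
    using that by (rule bounded_subset) auto
  show ?thesis
    unfolding CB_inf_def smooth_def differentiable_on_def
  proof (intro CollectI conjI ballI)
    fix vs :: "'b list" assume vs: "vs \<in> lists Basis"
    show "iter_partial vs (\<lambda>x. a (x, 0)) differentiable (at x)" for x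
      using iter[OF vs] by blast
    have "bounded (range (iter_partial (map (\<lambda>v. (v, 0)) vs) a))"
      using a lists[OF vs] unfolding CB_inf_def by blast
    then show "bounded (range (iter_partial vs (\<lambda>x. a (x, 0))))"
      unfolding conjunct1[OF iter[OF vs]] by (rule bd)
  qed
qed

section \<open>Both composites on Gaussians\<close>

text \<open>Moving J to the other argument shows that the number equals its own negative. It clears
  the terms p . Jp from the phases below.\<close>

lemma skew_inner:
  fixes J :: "real^'n^'n"
  assumes "transpose J = - J"
  shows "x \<bullet> (J *v x) = 0"
proof -
  have "x \<bullet> (J *v x) = (transpose J *v x) \<bullet> x"
    by (metis dot_lmul_matrix transpose_matrix_vector transpose_transpose inner_commute)
  also have "\<dots> = - (x \<bullet> (J *v x))"
  proof -
    have "(- J) *v x = - (J *v x)"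
      by (simp add: vec_eq_iff matrix_vector_mult_def sum_negf)
    then show ?thesis
      unfolding assms by (simp add: inner_commute)
  qed
  finally show ?thesis by simp
qed

lemma integrable_scaleR_bounded:
  fixes H :: "'b::euclidean_space \<Rightarrow> 'a::{banach, second_countable_topology}"
  assumes f: "integrable lborel f" and H: "continuous_on UNIV H" "\<And>z. norm (H z) \<le> B"
  shows "integrable lborel (\<lambda>z. f z *\<^sub>R H z)"
proof (rule Bochner_Integration.integrable_bound)
  show "integrable lborel (\<lambda>z. f z * B)"
    using f by simp
  have [measurable]: "H \<in> borel_measurable borel" "f \<in> borel_measurable borel"
    using borel_measurable_continuous_onI[OF H(1)] f by auto
  show "(\<lambda>z. f z *\<^sub>R H z) \<in> borel_measurable lborel"
    by measurable
  have "norm (f z *\<^sub>R H z) \<le> norm (f z * B)" for z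
    using order_trans[OF H(2) abs_ge_self] by (simp add: abs_mult mult_left_mono)
  then show "AE z in lborel. norm (f z *\<^sub>R H z) \<le> norm (f z * B)"
    by (intro AE_I2)
qed

lemma gauss_le_1: "gauss s x \<le> 1"
  by (simp add: gauss_def)

text \<open>The two weights form a single Gaussian on the product space, so one concentration
  argument handles p and \<xi> together.\<close>

lemma gauss_Pair: "gauss s ((p, \<xi>) - (q, 0)) = gauss s (p - q) * gauss s \<xi>"
  by (simp add: gauss_def norm_Pair add_divide_distrib diff_divide_distrib flip: exp_add)

lemma matrix_continuous [continuous_intros]:
  fixes J :: "real^'n^'n"
  shows "continuous_on S f \<Longrightarrow> continuous_on S (\<lambda>x. J *v f x)"
  by (rule continuous_on_compose2[OF matrix_vector_mult_linear_continuous_on]) auto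

definition fourier_const :: "nat \<Rightarrow> real" where
  "fourier_const n = (2 * pi) powr (- real n / 2)"

text \<open>The peak value, at \<xi> = q, of the Fourier transform of \<open>gaussian s q 0\<close>.
  For s > 0 it equals s^(-n); only that it is nonzero matters in the end.\<close>

definition gauss_const :: "nat \<Rightarrow> real \<Rightarrow> real" where
  "gauss_const n s = fourier_const n * (sqrt (2 * pi) / s) ^ n"

text \<open>The common shape of \<open>a(x,D) R\<^sub>G f\<close> and \<open>R\<^sub>G a(x,D) f\<close> for Gaussian \<open>f\<close>, \<open>G\<close>: an average,
  concentrated at \<open>(p, \<xi>) = (q, 0)\<close>, over the Weyl translations \<open>W\<^sub>p f(x) = e\<^bsup>ix\<cdot>p\<^esup> f(x - Jp)\<close>.\<close>

definition weyl_average ::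
  "real^'n^'n \<Rightarrow> real \<Rightarrow> real^'n \<Rightarrow> real^'n \<Rightarrow> (real^'n \<Rightarrow> real^'n \<Rightarrow> 'a) \<Rightarrow> 'a::separable_cstar_algebra" where
  "weyl_average J s q x A = (LINT p|lborel. LINT \<xi>|lborel.
     (gauss s (p - q) * gauss s \<xi>) *\<^sub>R cis (x \<bullet> p + (x - J *v p) \<bullet> \<xi>) *\<^sub>C A p \<xi>)"

text \<open>Composing operators yields an iterated integral, while the concentration argument wants
  one integral over the product space. Boundedness of A makes the Gaussian a majorant and so gives
  both integrability and Fubini.\<close>

lemma weyl_average_eq:
  fixes A :: "real^'n \<Rightarrow> real^'n \<Rightarrow> 'a::separable_cstar_algebra"
  assumes s: "s > 0" and A: "continuous_on UNIV (\<lambda>(p, \<xi>). A p \<xi>)" "\<And>p \<xi>. norm (A p \<xi>) \<le> B"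
  shows "integrable lborel
      (\<lambda>z. gauss s (z - (q, 0)) *\<^sub>R cis (x \<bullet> fst z + (x - J *v fst z) \<bullet> snd z) *\<^sub>C A (fst z) (snd z))" (is "integrable lborel ?h")
    and "weyl_average J s q x A =
      (LINT z|lborel. gauss s (z - (q, 0)) *\<^sub>R cis (x \<bullet> fst z + (x - J *v fst z) \<bullet> snd z) *\<^sub>C A (fst z) (snd z))"
proof -
  show int: "integrable lborel ?h"
    using A unfolding split_beta
    by (intro integrable_scaleR_bounded[where B = B] integrable_gauss s continuous_intros) (auto simp: norm_scaleC)
  have "integral\<^sup>L lborel ?h = (LINT p|lborel. LINT \<xi>|lborel. ?h (p, \<xi>))"
    using lborel_pair.integral_fst'[of ?h] int by (simp add: lborel_prod)
  then show "weyl_average J s q x A = integral\<^sup>L lborel ?h"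
    unfolding weyl_average_def gauss_Pair fst_conv snd_conv by simp
qed

locale gaussian_test =
  fixes J :: "real^'n^'n" and a :: "(real^'n) \<times> (real^'n) \<Rightarrow> 'a::separable_cstar_algebra"
    and s :: real and q :: "real^'n" and d b :: 'a
  assumes skew: "transpose J = - J" and s: "s > 0"
    and a: "continuous_on UNIV a" and bdd: "\<exists>B. \<forall>z. norm (a z) \<le> B"
begin

abbreviation "f \<equiv> \<lambda>x. gaussian s 0 0 x *\<^sub>C d"
abbreviation "g \<equiv> \<lambda>x. gaussian s q 0 x *\<^sub>C b"

lemma f: "f \<in> schwartz" and g: "g \<in> schwartz"
  by (intro schwartz_scaleC schwartz_gaussian s)+

text \<open>The roles are reversed here: h supplies the symbol h(y - Jp), and \<open>g\<close> is
  the function acted upon. The weight is the Fourier transform of \<open>g\<close>, and b stays to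
  the right of h.\<close>

lemma right_mult_gaussian:
  assumes h: "h \<in> schwartz"
  shows "right_mult J g h y = (fourier_const CARD('n) * gauss_const CARD('n) s) *\<^sub>R (LINT p|lborel. (gauss s (p - q) *\<^sub>R cis (y \<bullet> p)) *\<^sub>C (h (y - J *v p) * b))"
proof -
  obtain B where "\<And>x. norm (h x) \<le> B"
    using schwartz_bounded[OF h] by blast
  then have "right_mult J g h y = pseudo_diff (\<lambda>(x, \<xi>). h (x - J *v \<xi>)) g y"
    unfolding right_mult_def by (intro deformed_product_eq_pseudo_diff schwartz_continuous h g)
  also have "\<dots> = fourier_const CARD('n) *\<^sub>R (LINT p|lborel. gauss_const CARD('n) s *\<^sub>R (gauss s (p - q) *\<^sub>R cis (y \<bullet> p)) *\<^sub>C (h (y - J *v p) * b))"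
    by (simp add: pseudo_diff_def fourier_gaussian[OF s] fourier_const_def gauss_const_def
        scaleC_scaleR_right scaleR_scaleC_left)
  finally show ?thesis
    by simp
qed

text \<open>The auxiliary \<open>h\<close> is the integrand of R_g f with the character of the
  Fourier transform absorbed. After Fubini the y-integral is the Fourier integral of a Gaussian
  centred at Jp, which yields the weight in \<xi> - p and a phase.\<close>

lemma fourier_right_mult_gaussian:
  "fourier (right_mult J g f) \<xi> = (fourier_const CARD('n) * gauss_const CARD('n) s * gauss_const CARD('n) s) *\<^sub>R
     (LINT p|lborel. (gauss s (p - q) * gauss s (\<xi> - p)) *\<^sub>R cis (- (\<xi> \<bullet> (J *v p)))) *\<^sub>C (d * b)"
proof -
  define h where "h = (\<lambda>p y. (gauss s (p - q) * gauss (inverse s) (y - J *v p)) *\<^sub>R cis ((p - \<xi>) \<bullet> y))"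
  have shear: "integrable lborel (\<lambda>(p, y). gauss s (p - q) * gauss (inverse s) (y - J *v p))"
    using integrable_gauss[of "inverse s" "0 :: real^'n"] s
    by (intro integrable_shear integrable_gauss continuous_intros) auto
  have "integrable lborel (\<lambda>z. (case z of (p, y) \<Rightarrow> gauss s (p - q) * gauss (inverse s) (y - J *v p)) *\<^sub>R
      cis ((fst z - \<xi>) \<bullet> snd z))"
    by (rule integrable_scaleR_bounded[OF shear, where B = 1]) (auto intro!: continuous_intros)
  then have int: "integrable (lborel \<Otimes>\<^sub>M lborel) (\<lambda>(p, y). h p y)"
    by (simp add: h_def lborel_prod case_prod_unfold)
  \<comment> \<open>The factor \<open>cis (\<xi> \<bullet> y)\<close> undoes the absorbed character,
    so it cancels when the Fourier transform is taken.\<close>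
  have right: "right_mult J g f y = (fourier_const CARD('n) * gauss_const CARD('n) s) *\<^sub>R (LINT p|lborel. cis (\<xi> \<bullet> y) * h p y) *\<^sub>C (d * b)" for y
  proof -
    have int_p: "integrable lborel (\<lambda>p. cis (\<xi> \<bullet> y) * h p y)"
    proof -
      have "integrable lborel (\<lambda>p. gauss s (p - q) *\<^sub>R
          (cis (\<xi> \<bullet> y) * (gauss (inverse s) (y - J *v p) *\<^sub>R cis ((p - \<xi>) \<bullet> y))))"
        by (rule integrable_scaleR_bounded[OF integrable_gauss[OF s], where B = 1])
          (auto intro!: continuous_intros simp: norm_mult gauss_nonneg gauss_le_1)
      then show ?thesis
        by (simp add: h_def mult_ac)
    qed
    have "(gauss s (p - q) *\<^sub>R cis (y \<bullet> p)) *\<^sub>C (f (y - J *v p) * b) = (cis (\<xi> \<bullet> y) * h p y) *\<^sub>C (d * b)" for p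
    proof -
      have "cis (\<xi> \<bullet> y) * cis ((p - \<xi>) \<bullet> y) = cis (y \<bullet> p)"
        by (simp add: cis_mult inner_diff_left inner_diff_right inner_commute)
      then have "cis (\<xi> \<bullet> y) * h p y = (gauss s (p - q) *\<^sub>R cis (y \<bullet> p)) * gaussian s 0 0 (y - J *v p)"
        by (simp add: h_def gaussian_eq_gauss scaleR_conv_of_real mult_ac)
      then show ?thesis
        by (simp add: mult_scaleC_left scaleC_scaleC)
    qed
    then show ?thesis
      unfolding right_mult_gaussian[OF f] using integral_scaleC_left[OF int_p, of "d * b"] by simp
  qed
  have "cis (- (\<xi> \<bullet> y)) * cis (\<xi> \<bullet> y) = 1" for y
    by (simp add: cis_mult)
  then have "cis (- (\<xi> \<bullet> y)) *\<^sub>C right_mult J g f y = (fourier_const CARD('n) * gauss_const CARD('n) s) *\<^sub>R (LINT p|lborel. h p y) *\<^sub>C (d * b)" for y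
    unfolding right by (simp add: scaleC_scaleR_right scaleC_scaleC flip: mult.assoc)
  then have "fourier (right_mult J g f) \<xi> = fourier_const CARD('n) *\<^sub>R (fourier_const CARD('n) * gauss_const CARD('n) s) *\<^sub>R (LINT y|lborel. (LINT p|lborel. h p y) *\<^sub>C (d * b))"
    by (simp add: fourier_def fourier_const_def)
  also have "(LINT y|lborel. (LINT p|lborel. h p y) *\<^sub>C (d * b)) = (LINT y|lborel. LINT p|lborel. h p y) *\<^sub>C (d * b)"
    by (rule integral_scaleC_left[OF lborel_pair.integrable_snd[OF int]])
  also have "(LINT y|lborel. LINT p|lborel. h p y) = (LINT p|lborel. LINT y|lborel. h p y)"
    by (rule lborel_pair.Fubini_integral[OF int])
  also have "\<dots> = (LINT p|lborel. (sqrt (2 * pi) / s) ^ CARD('n) *\<^sub>R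
      (gauss s (p - q) * gauss s (\<xi> - p)) *\<^sub>R cis (- (\<xi> \<bullet> (J *v p))))"
  proof (rule Bochner_Integration.integral_cong)
    fix p
    \<comment> \<open>Recentring at Jp leaves the phase (p - \<xi>) . Jp, which equals -\<xi> . Jp
      because J is skew.\<close>
    have "(LINT y|lborel. h p y) = (LINT y|lborel. h p (J *v p + y))"
      unfolding h_def
      by (intro integral_lborel_translate[symmetric] borel_measurable_continuous_onI continuous_intros)
    also have "\<dots> = (LINT y|lborel. (gauss s (p - q) *\<^sub>R cis (- (\<xi> \<bullet> (J *v p)))) *
        (cis ((p - \<xi>) \<bullet> y) * of_real (gauss (inverse s) y)))"
    proof (rule Bochner_Integration.integral_cong)
      fix y
      have "cis ((p - \<xi>) \<bullet> (J *v p + y)) = cis (- (\<xi> \<bullet> (J *v p))) * cis ((p - \<xi>) \<bullet> y)"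
        using skew_inner[OF skew, of p] by (simp add: cis_mult inner_diff_left inner_add_right algebra_simps)
      then show "h p (J *v p + y) = (gauss s (p - q) *\<^sub>R cis (- (\<xi> \<bullet> (J *v p)))) *
          (cis ((p - \<xi>) \<bullet> y) * of_real (gauss (inverse s) y))"
        by (simp add: h_def scaleR_conv_of_real)
    qed simp
    also have "\<dots> = (gauss s (p - q) *\<^sub>R cis (- (\<xi> \<bullet> (J *v p)))) *
        of_real ((sqrt (2 * pi) / s) ^ CARD('n) * gauss s (p - \<xi>))"
      using integral_cis_gauss[OF s, of "p - \<xi>"] by simp
    finally show "(LINT y|lborel. h p y) = (sqrt (2 * pi) / s) ^ CARD('n) *\<^sub>R
      (gauss s (p - q) * gauss s (\<xi> - p)) *\<^sub>R cis (- (\<xi> \<bullet> (J *v p)))"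
      by (simp add: scaleR_conv_of_real gauss_minus_commute[of s p] mult_ac)
  qed simp
  also have "\<dots> = (sqrt (2 * pi) / s) ^ CARD('n) *\<^sub>R
      (LINT p|lborel. (gauss s (p - q) * gauss s (\<xi> - p)) *\<^sub>R cis (- (\<xi> \<bullet> (J *v p))))"
    by (rule integral_scaleR_right)
  finally show ?thesis
    by (simp add: gauss_const_def scaleR_scaleC_left mult_ac)
qed

text \<open>With the p-integral moved outside, the weight in \<xi> - p is centred by replacing \<xi>
  with p + \<xi>. This puts the shift into the second argument of \<open>a\<close>.\<close>

lemma pseudo_diff_right_mult_gaussian:
  "pseudo_diff a (right_mult J g f) x =
    (fourier_const CARD('n) * fourier_const CARD('n) * gauss_const CARD('n) s * gauss_const CARD('n) s) *\<^sub>R weyl_average J s q x (\<lambda>p \<xi>. a (x, p + \<xi>) * (d * b))"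
proof -
  obtain B where B: "\<And>z. norm (a z) \<le> B"
    using bdd by blast
  define k where "k = (\<lambda>p \<xi>. cis (- (\<xi> \<bullet> (J *v p))))"
  define h where "h = (\<lambda>p \<xi>. (gauss s (p - q) * gauss s (\<xi> - p)) *\<^sub>R k p \<xi> *\<^sub>C (cis (x \<bullet> \<xi>) *\<^sub>C (a (x, \<xi>) * (d * b))))"
  note [continuous_intros] = continuous_on_compose2[OF a _ subset_UNIV]
  have shear: "integrable lborel (\<lambda>(p, \<xi>). gauss s (p - q) * gauss s (\<xi> - p :: real^'n))"
    using integrable_gauss[OF s, of "0 :: real^'n"]
    by (intro integrable_shear integrable_gauss continuous_intros s) auto
  have bound: "norm (a z * (d * b)) \<le> B * norm (d * b)" for z
    by (rule norm_mult_ineq[THEN order_trans]) (intro mult_right_mono B norm_ge_zero)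
  have "integrable lborel (\<lambda>z. (case z of (p, \<xi>) \<Rightarrow> gauss s (p - q) * gauss s (\<xi> - p)) *\<^sub>R
      k (fst z) (snd z) *\<^sub>C (cis (x \<bullet> snd z) *\<^sub>C (a (x, snd z) * (d * b))))"
    by (rule integrable_scaleR_bounded[OF shear, where B = "B * norm (d * b)"])
      (auto intro!: continuous_intros bound simp: norm_scaleC k_def)
  then have int: "integrable (lborel \<Otimes>\<^sub>M lborel) (\<lambda>(p, \<xi>). h p \<xi>)"
    by (simp add: h_def lborel_prod case_prod_unfold)
  have "cis (x \<bullet> \<xi>) *\<^sub>C (a (x, \<xi>) * fourier (right_mult J g f) \<xi>) =
      (fourier_const CARD('n) * gauss_const CARD('n) s * gauss_const CARD('n) s) *\<^sub>R (LINT p|lborel. h p \<xi>)" for \<xi>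
  proof -
    have "integrable lborel (\<lambda>p. gauss s (p - q) *\<^sub>R (gauss s (\<xi> - p) *\<^sub>R k p \<xi>))"
      by (rule integrable_scaleR_bounded[OF integrable_gauss[OF s], where B = 1])
        (auto intro!: continuous_intros simp: gauss_nonneg gauss_le_1 k_def)
    then have "integrable lborel (\<lambda>p. (gauss s (p - q) * gauss s (\<xi> - p)) *\<^sub>R k p \<xi>)"
      by simp
    from integral_scaleC_left[OF this, of "cis (x \<bullet> \<xi>) *\<^sub>C (a (x, \<xi>) * (d * b))"]
    show ?thesis
      unfolding fourier_right_mult_gaussian
      by (simp add: h_def k_def scaleR_scaleC_left scaleC_scaleR_right mult_scaleC_right scaleC_scaleC mult.commute)
  qed
  then have "pseudo_diff a (right_mult J g f) x =
      fourier_const CARD('n) *\<^sub>R (fourier_const CARD('n) * gauss_const CARD('n) s * gauss_const CARD('n) s) *\<^sub>R (LINT \<xi>|lborel. LINT p|lborel. h p \<xi>)"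
    by (simp add: pseudo_diff_def fourier_const_def)
  also have "(LINT \<xi>|lborel. LINT p|lborel. h p \<xi>) = (LINT p|lborel. LINT \<xi>|lborel. h p \<xi>)"
    by (rule lborel_pair.Fubini_integral[OF int])
  also have "\<dots> = weyl_average J s q x (\<lambda>p \<xi>. a (x, p + \<xi>) * (d * b))"
    unfolding weyl_average_def
  proof (rule Bochner_Integration.integral_cong)
    fix p
    have "(LINT \<xi>|lborel. h p \<xi>) = (LINT \<xi>|lborel. h p (p + \<xi>))"
      unfolding h_def k_def
      by (intro integral_lborel_translate[symmetric] borel_measurable_continuous_onI continuous_intros)
    also have "\<dots> = (LINT \<xi>|lborel. (gauss s (p - q) * gauss s \<xi>) *\<^sub>R cis (x \<bullet> p + (x - J *v p) \<bullet> \<xi>) *\<^sub>C (a (x, p + \<xi>) * (d * b)))"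
    proof (rule Bochner_Integration.integral_cong)
      fix \<xi>
      \<comment> \<open>Of the phase -(p + \<xi>) . Jp only -\<xi> . Jp survives; joined to x .
        \<xi> it gives (x - Jp) . \<xi>, the phase of the other composite.\<close>
      have "k p (p + \<xi>) * cis (x \<bullet> (p + \<xi>)) = cis (x \<bullet> p + (x - J *v p) \<bullet> \<xi>)"
        using skew_inner[OF skew, of p]
        by (simp add: k_def cis_mult inner_add_left inner_add_right inner_diff_left inner_diff_right
              inner_commute algebra_simps)
      then show "h p (p + \<xi>) = (gauss s (p - q) * gauss s \<xi>) *\<^sub>R cis (x \<bullet> p + (x - J *v p) \<bullet> \<xi>) *\<^sub>C (a (x, p + \<xi>) * (d * b))"
        by (simp add: h_def scaleC_scaleC)
    qed simp
    finally show "(LINT \<xi>|lborel. h p \<xi>) = (LINT \<xi>|lborel. (gauss s (p - q) * gauss s \<xi>) *\<^sub>R cis (x \<bullet> p + (x - J *v p) \<bullet> \<xi>) *\<^sub>C (a (x, p + \<xi>) * (d * b)))" .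
  qed simp
  finally show ?thesis
    by (simp add: mult_ac)
qed

text \<open>The integrals already stand in the required order, p outside and \<xi> inside; b only
  has to be moved into the inner one. The hypothesis makes the integral formula for right
  multiplication applicable to a(x,D) f.\<close>

lemma right_mult_pseudo_diff_gaussian:
  assumes "pseudo_diff a f \<in> schwartz"
  shows "right_mult J g (pseudo_diff a f) x =
    (fourier_const CARD('n) * fourier_const CARD('n) * gauss_const CARD('n) s * gauss_const CARD('n) s) *\<^sub>R weyl_average J s q x (\<lambda>p \<xi>. a (x - J *v p, \<xi>) * (d * b))"
proof -
  obtain B where B: "\<And>z. norm (a z) \<le> B"
    using bdd by blast
  note [continuous_intros] = continuous_on_compose2[OF a _ subset_UNIV]
  have int: "integrable lborel (\<lambda>\<xi>. gauss s \<xi> *\<^sub>R cis (z \<bullet> \<xi>) *\<^sub>C (a (z, \<xi>) * d))" for z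
  proof (rule integrable_scaleR_bounded[where B = "B * norm d"])
    show "integrable lborel (gauss s :: real^'n \<Rightarrow> real)"
      using integrable_gauss[OF s, of "0 :: real^'n"] by simp
    show "norm (cis (z \<bullet> \<xi>) *\<^sub>C (a (z, \<xi>) * d)) \<le> B * norm d" for \<xi>
      unfolding norm_scaleC
      by (simp, rule norm_mult_ineq[THEN order_trans]) (intro mult_right_mono B norm_ge_zero)
  qed (intro continuous_intros)
  have P: "pseudo_diff a f z = (fourier_const CARD('n) * gauss_const CARD('n) s) *\<^sub>R (LINT \<xi>|lborel. gauss s \<xi> *\<^sub>R cis (z \<bullet> \<xi>) *\<^sub>C (a (z, \<xi>) * d))" for z
  proof -
    have "cis (z \<bullet> \<xi>) *\<^sub>C (a (z, \<xi>) * fourier f \<xi>) = gauss_const CARD('n) s *\<^sub>R gauss s \<xi> *\<^sub>R cis (z \<bullet> \<xi>) *\<^sub>C (a (z, \<xi>) * d)" for \<xi>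
      by (simp add: fourier_gaussian[OF s] fourier_const_def gauss_const_def scaleC_scaleR_right)
    then show ?thesis
      by (simp add: pseudo_diff_def fourier_const_def scaleR_scaleR[symmetric] del: scaleR_scaleR)
  qed
  have "(gauss s (p - q) *\<^sub>R cis (x \<bullet> p)) *\<^sub>C (pseudo_diff a f (x - J *v p) * b) =
      (fourier_const CARD('n) * gauss_const CARD('n) s) *\<^sub>R (LINT \<xi>|lborel. (gauss s (p - q) * gauss s \<xi>) *\<^sub>R
        cis (x \<bullet> p + (x - J *v p) \<bullet> \<xi>) *\<^sub>C (a (x - J *v p, \<xi>) * (d * b)))" for p
  proof -
    define z where "z = x - J *v p"
    have "(LINT \<xi>|lborel. gauss s \<xi> *\<^sub>R cis (z \<bullet> \<xi>) *\<^sub>C (a (z, \<xi>) * d)) * b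
        = (LINT \<xi>|lborel. gauss s \<xi> *\<^sub>R cis (z \<bullet> \<xi>) *\<^sub>C (a (z, \<xi>) * d) * b)"
      by (rule Bochner_Integration.integral_mult_left[OF int, symmetric])
    also have "(gauss s (p - q) *\<^sub>R cis (x \<bullet> p)) *\<^sub>C \<dots> =
        (LINT \<xi>|lborel. (gauss s (p - q) *\<^sub>R cis (x \<bullet> p)) *\<^sub>C (gauss s \<xi> *\<^sub>R cis (z \<bullet> \<xi>) *\<^sub>C (a (z, \<xi>) * d) * b))"
      by (rule integral_scaleC_right[symmetric])
    also have "\<dots> = (LINT \<xi>|lborel. (gauss s (p - q) * gauss s \<xi>) *\<^sub>R
        cis (x \<bullet> p + z \<bullet> \<xi>) *\<^sub>C (a (z, \<xi>) * (d * b)))"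
      by (intro Bochner_Integration.integral_cong refl)
        (simp add: scaleR_scaleC_left scaleC_scaleR_right mult_scaleC_left scaleC_scaleC cis_mult mult.assoc)
    finally show ?thesis
      unfolding P z_def[symmetric] by (simp add: scaleC_scaleR_right)
  qed
  then show ?thesis
    unfolding right_mult_gaussian[OF assms] weyl_average_def by (simp add: mult_ac)
qed

end

section \<open>Invariance of the symbol\<close>

text \<open>The common oscillating factor is kept inside \<open>H\<close>, which makes
  \<open>H\<close> bounded, continuous and independent of s. Being unimodular, the factor can be
  removed once \<open>H\<close> is known to vanish at (q, 0).\<close>

lemma symbol_invariant_of_gaussian_commutation:
  fixes J :: "real^'n^'n" and a :: "(real^'n) \<times> (real^'n) \<Rightarrow> 'a::separable_cstar_algebra"
  assumes skew: "transpose J = - J"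
    and a: "continuous_on UNIV a" and B: "\<And>z. norm (a z) \<le> B"
    and schwartz: "\<And>\<phi>. \<phi> \<in> schwartz \<Longrightarrow> pseudo_diff a \<phi> \<in> schwartz"
    and commute: "\<And>s d b. s > 0 \<Longrightarrow>
      pseudo_diff a (right_mult J (\<lambda>x. gaussian s q 0 x *\<^sub>C b) (\<lambda>x. gaussian s 0 0 x *\<^sub>C d)) x =
      right_mult J (\<lambda>x. gaussian s q 0 x *\<^sub>C b) (pseudo_diff a (\<lambda>x. gaussian s 0 0 x *\<^sub>C d)) x"
  shows "a (x, q) = a (x - J *v q, 0)"
proof -
  note [continuous_intros] = continuous_on_compose2[OF a _ subset_UNIV]
  have "(a (x, q) - a (x - J *v q, 0)) * d * b = 0" for d b
  proof -
    define A1 where "A1 = (\<lambda>p \<xi>. a (x, p + \<xi>) * (d * b))"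
    define A2 where "A2 = (\<lambda>p \<xi>. a (x - J *v p, \<xi>) * (d * b))"
    define H where "H = (\<lambda>z. cis (x \<bullet> fst z + (x - J *v fst z) \<bullet> snd z) *\<^sub>C
      (A1 (fst z) (snd z) - A2 (fst z) (snd z)))"
    have contA: "continuous_on UNIV (\<lambda>(p, \<xi>). A1 p \<xi>)" "continuous_on UNIV (\<lambda>(p, \<xi>). A2 p \<xi>)"
      unfolding A1_def A2_def case_prod_unfold by (intro continuous_intros)+
    have bound: "norm (A1 p \<xi>) \<le> B * norm (d * b)" "norm (A2 p \<xi>) \<le> B * norm (d * b)" for p \<xi>
      unfolding A1_def A2_def by (rule norm_mult_ineq[THEN order_trans], intro mult_right_mono B norm_ge_zero)+
    have "H (q, 0) = 0"
    proof (rule eq_0_if_gaussian_averages_eq_0)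
      show "continuous_on UNIV H"
        using contA unfolding H_def case_prod_unfold by (intro continuous_intros)
      show "norm (H z) \<le> 2 * (B * norm (d * b))" for z
        using norm_triangle_ineq4[of "A1 (fst z) (snd z)" "A2 (fst z) (snd z)"] bound[of "fst z" "snd z"]
        by (simp add: H_def norm_scaleC)
      fix s :: real assume s: "s > 0"
      interpret gaussian_test J a s q d b
        by (rule gaussian_test.intro[OF skew s a], rule exI, rule allI, rule B)
      have "(fourier_const CARD('n) * fourier_const CARD('n) * gauss_const CARD('n) s * gauss_const CARD('n) s)
          *\<^sub>R (weyl_average J s q x A1 - weyl_average J s q x A2) = 0"
        using commute[OF s, of b d] pseudo_diff_right_mult_gaussian[of x]
          right_mult_pseudo_diff_gaussian[OF schwartz[OF f], of x]
        unfolding A1_def A2_def scaleR_diff_right by simp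
      then have "weyl_average J s q x A1 = weyl_average J s q x A2"
        using s by (simp add: fourier_const_def gauss_const_def)
      then have "(LINT z|lborel. gauss s (z - (q, 0)) *\<^sub>R H z) = 0"
        using weyl_average_eq[where q = q and x = x and J = J, OF s contA(1) bound(1)]
          weyl_average_eq[where q = q and x = x and J = J, OF s contA(2) bound(2)]
        by (simp add: H_def scaleC.diff_right scaleR_diff_right)
      then show "(LINT z|lborel. exp (- (norm (z - (q, 0)))\<^sup>2 / (2 * s\<^sup>2)) *\<^sub>R H z) = 0"
        by (simp add: gauss_def)
    qed
    then have "cis (- (x \<bullet> q)) *\<^sub>C cis (x \<bullet> q) *\<^sub>C (A1 q 0 - A2 q 0) = 0"
      by (simp add: H_def scaleC.zero_right)
    then have "A1 q 0 = A2 q 0"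
      by (simp add: scaleC_scaleC cis_mult scaleC_one)
    then show ?thesis
      by (simp add: A1_def A2_def left_diff_distrib mult.assoc)
  qed
  \<comment> \<open>The test elements are cancelled one at a time: b for each fixed d, and d
    afterwards.\<close>
  then have "(a (x, q) - a (x - J *v q, 0)) * d = 0" for d
    by (rule left_annihilator_zero)
  then have "a (x, q) - a (x - J *v q, 0) = 0"
    by (rule left_annihilator_zero)
  then show ?thesis
    by simp
qed

section \<open>Return from the completion to functions\<close>

text \<open>Equal images have equal inner products with every embedded Schwartz function. Against a
  Gaussian at x0 with coefficient b these are Gaussian averages of
  \<open>star b * (u x - v x)\<close>, so this function vanishes at x0 for every b.\<close>

lemma (in schwartz_completion) emb_inj:
  assumes u: "u \<in> schwartz" and v: "v \<in> schwartz" and eq: "\<iota> u = \<iota> v"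
  shows "u = v"
proof
  fix x0
  obtain Bu Bv where B: "\<And>x. norm (u x) \<le> Bu" "\<And>x. norm (v x) \<le> Bv"
    using schwartz_bounded[OF u] schwartz_bounded[OF v] by metis
  have star_bdd: "continuous_on UNIV (\<lambda>x. star b * w x)" "norm (star b * w x) \<le> norm (star b) * C"
    if "continuous_on UNIV w" "\<And>x. norm (w x) \<le> C" for b :: 'a and w :: "real^'n \<Rightarrow> 'a" and C x
    using that by (auto intro!: continuous_intros norm_mult_ineq[THEN order_trans] mult_left_mono)
  have "star b * (u x0 - v x0) = 0" for b
  proof (rule eq_0_if_gaussian_averages_eq_0[where H = "\<lambda>x. star b * (u x - v x)"])
    show "continuous_on UNIV (\<lambda>x. star b * (u x - v x))"
      by (intro continuous_intros schwartz_continuous u v)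
    show "norm (star b * (u x - v x)) \<le> norm (star b) * (Bu + Bv)" for x
      by (intro norm_mult_ineq[THEN order_trans] mult_left_mono norm_triangle_ineq4[THEN order_trans]
          add_mono B norm_ge_zero)
    fix s :: real assume s: "s > 0"
    \<comment> \<open>The inverse is taken so that the modulus of the Gaussian is
      \<open>gauss s\<close>, which concentrates as s tends to 0.\<close>
    define h where "h = (\<lambda>x. gaussian (inverse s) 0 x0 x *\<^sub>C b)"
    have h: "h \<in> schwartz"
      unfolding h_def using s by (intro schwartz_scaleC schwartz_gaussian) simp
    have "star (h x) = gauss s (x - x0) *\<^sub>R star b" for x
      using s by (simp add: h_def gaussian_eq_gauss star_scaleC scaleR_scaleC)
    then have inner: "schwartz_inner h w = (LINT x|lborel. gauss s (x - x0) *\<^sub>R (star b * w x))" for w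
      by (simp add: schwartz_inner_def)
    have int: "integrable lborel (\<lambda>x. gauss s (x - x0) *\<^sub>R (star b * w x))"
      if "continuous_on UNIV w" "\<And>x. norm (w x) \<le> C" for w C
      using star_bdd[OF that] by (rule integrable_scaleR_bounded[OF integrable_gauss[OF s]])
    have "schwartz_inner h u = schwartz_inner h v"
      using emb_ip[OF h u] emb_ip[OF h v] eq by simp
    then show "(LINT x|lborel. exp (- (norm (x - x0))\<^sup>2 / (2 * s\<^sup>2)) *\<^sub>R (star b * (u x - v x))) = 0"
      unfolding inner gauss_def[symmetric]
      using int[OF schwartz_continuous[OF u] B(1)] int[OF schwartz_continuous[OF v] B(2)]
      by (simp add: right_diff_distrib scaleR_diff_right)
  qed
  then have "u x0 - v x0 = 0"
    by (rule right_annihilator_zero)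
  then show "u x0 = v x0"
    by simp
qed

theorem mainTheorem3:
  fixes J :: "real^'n^'n"
    and a :: "(real^'n) \<times> (real^'n) \<Rightarrow> 'a::separable_cstar_algebra"
    and ip :: "'e::complex_banach \<Rightarrow> 'e \<Rightarrow> 'a"
    and act :: "'e \<Rightarrow> 'a \<Rightarrow> 'e"
    and \<iota> :: "(real^'n \<Rightarrow> 'a) \<Rightarrow> 'e"
    and T :: "'e \<Rightarrow> 'e"
    and R :: "(real^'n \<Rightarrow> 'a) \<Rightarrow> 'e \<Rightarrow> 'e"
  assumes skew: "transpose J = - J"
    and E: "schwartz_completion ip act \<iota>"
    and a: "a \<in> CB_inf"
    and T: "extends_to \<iota> (pseudo_diff a) T"
    and R: "\<And>G. G \<in> schwartz \<Longrightarrow> extends_to \<iota> (right_mult J G) (R G)"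
    and commute: "\<And>G. G \<in> schwartz \<Longrightarrow> T \<circ> R G = R G \<circ> T"
  shows "\<exists>F \<in> CB_inf.
           extends_to \<iota> (pseudo_diff (\<lambda>(x, \<xi>). F (x - J *v \<xi>))) T \<and>
           extends_to \<iota> (left_mult J F) T"
proof -
  interpret schwartz_completion ip act \<iota>
    by (rule E)
  obtain B where B: "\<And>z. norm (a z) \<le> B"
    using CB_inf_bounded[OF a] by blast
  \<comment> \<open>\<open>extends_to\<close> carries the invariance of the Schwartz space along
    with the extension property, so both orders of composition can be evaluated on
    functions.\<close>
  have P: "pseudo_diff a \<phi> \<in> schwartz" "T (\<iota> \<phi>) = \<iota> (pseudo_diff a \<phi>)" if "\<phi> \<in> schwartz" for \<phi>
    using T that by (auto simp: extends_to_def)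
  have RG: "right_mult J G \<phi> \<in> schwartz" "R G (\<iota> \<phi>) = \<iota> (right_mult J G \<phi>)"
    if "G \<in> schwartz" "\<phi> \<in> schwartz" for G \<phi>
    using R[OF that(1)] that(2) by (auto simp: extends_to_def)
  have pointwise: "pseudo_diff a (right_mult J G \<phi>) = right_mult J G (pseudo_diff a \<phi>)"
    if G: "G \<in> schwartz" and \<phi>: "\<phi> \<in> schwartz" for G \<phi>
  proof (rule emb_inj)
    show "\<iota> (pseudo_diff a (right_mult J G \<phi>)) = \<iota> (right_mult J G (pseudo_diff a \<phi>))"
      using fun_cong[OF commute[OF G], of "\<iota> \<phi>"] by (simp add: P RG G \<phi>)
  qed (intro P RG G \<phi>)+
  define F where "F = (\<lambda>x. a (x, 0))"
  have F: "F \<in> CB_inf"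
    unfolding F_def by (rule CB_inf_restrict[OF a])
  have "a (x, \<xi>) = F (x - J *v \<xi>)" for x \<xi>
    unfolding F_def
    by (intro symbol_invariant_of_gaussian_commutation[OF skew CB_inf_continuous[OF a] B P(1)])
      (auto simp: pointwise schwartz_scaleC schwartz_gaussian)
  then have a_eq: "a = (\<lambda>(x, \<xi>). F (x - J *v \<xi>))"
    by auto
  \<comment> \<open>Once \<open>a\<close> has the form F(x - J\<xi>), the claim about the symbol is
    the assumption on \<open>T\<close>; the claim about L_F needs agreement on Schwartz functions
    only.\<close>
  have "left_mult J F \<phi> = pseudo_diff a \<phi>" if "\<phi> \<in> schwartz" for \<phi>
  proof
    fix x
    have "norm (F y) \<le> B" for y
      by (simp add: F_def B)
    from deformed_product_eq_pseudo_diff[OF CB_inf_continuous[OF F] this that]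
    show "left_mult J F \<phi> x = pseudo_diff a \<phi> x"
      by (simp add: left_mult_def a_eq)
  qed
  then have "extends_to \<iota> (left_mult J F) T"
    using T by (simp add: extends_to_def)
  with F T show ?thesis
    unfolding a_eq by blast
qed

end
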